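(* There exists a weakly locally finite division ring $D$ which is not algebraic over its center.
   Context: A division ring $D$ is centrally finite if it is finite-dimensional as a vector space over its center. A division ring $D$ is weakly locally finite if for every finite subset $S$ of $D$, the division subring of $D$ generated by $S$ is centrally finite (i.e. finite-dimensional over its own center). A division ring $D$ with center $F$ is algebraic if every element of $D$ is algebraic over $F$. *)

theory Defs
  imports "HOL-Algebra.Algebra"
begin

text \<open>Division rings: not necessarily commutative, nontrivial, every nonzero element invertible.
  The name \<open>division_ring\<close> is already taken by the type class.\<close>

locale skew_field = ring R for R (structure) +
  assumes one_not_zero: "\<one> \<noteq> \<zero>"
    and skew_field_Units: "Units R = carrier R - {\<zero>}"

definition center :: "('a, 'b) ring_scheme \<Rightarrow> 'a set"
  where "center R = {z \<in> carrier R. \<forall>x \<in> carrier R. z \<otimes>\<^bsub>R\<^esub> x = x \<otimes>\<^bsub>R\<^esub> z}"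

definition centrally_finite :: "('a, 'b) ring_scheme \<Rightarrow> bool"
  where "centrally_finite R \<longleftrightarrow> ring.finite_dimension R (center R) (carrier R)"

text \<open>Despite its name, \<^const>\<open>generate_field\<close> does not involve commutativity: it is the closure of
  \<open>H \<union> {1}\<close> under addition, negation, multiplication and inverses of nonzero elements. In a
  division ring it is therefore the division subring generated by \<open>H\<close>, as the next two lemmas
  record.\<close>

lemma (in skew_field) generate_field_skew_field:
  assumes "H \<subseteq> carrier R"
  shows "subring (generate_field R H) R"
    and "skew_field (R \<lparr>carrier := generate_field R H\<rparr>)"
proof -
  have sub: "generate_field R H \<subseteq> carrier R"
  proof
    fix h assume "h \<in> generate_field R H"
    then show "h \<in> carrier R"
      using assms skew_field_Units by (induction rule: generate_field.induct) auto
  qed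
  show sr: "subring (generate_field R H) R"
    using sub by (intro subringI) (auto intro: generate_field.intros)
  have "x \<in> Units (R \<lparr>carrier := generate_field R H\<rparr>)"
    if "x \<in> generate_field R H" "x \<noteq> \<zero>" for x
  proof -
    have "x \<in> Units R" using that sub skew_field_Units by auto
    moreover have "inv x \<in> generate_field R H" using that by (rule generate_field.m_inv)
    ultimately show ?thesis
      using that(1) by (auto simp: Units_def intro!: bexI[of _ "inv x"])
        (metis Units_l_inv Units_r_inv \<open>x \<in> Units R\<close>)+
  qed
  moreover have "x \<noteq> \<zero>" if "x \<in> Units (R \<lparr>carrier := generate_field R H\<rparr>)" for x
  proof
    assume "x = \<zero>"
    with that obtain y where "y \<in> generate_field R H" "y \<otimes> \<zero> = \<one>"
      by (auto simp: Units_def)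
    then show False using sub one_not_zero by auto
  qed
  ultimately have "Units (R \<lparr>carrier := generate_field R H\<rparr>) = generate_field R H - {\<zero>}"
    by (auto simp: Units_def)
  then show "skew_field (R \<lparr>carrier := generate_field R H\<rparr>)"
    using subring_is_ring[OF sr] one_not_zero
    by (simp add: skew_field_def skew_field_axioms_def)
qed

lemma (in skew_field) generate_field_least:
  assumes E: "subring E R" "skew_field (R \<lparr>carrier := E\<rparr>)" and "H \<subseteq> E"
  shows "generate_field R H \<subseteq> E"
proof
  interpret E: skew_field "R \<lparr>carrier := E\<rparr>" by (rule E(2))
  fix h assume "h \<in> generate_field R H"
  then show "h \<in> E"
  proof (induction rule: generate_field.induct)
    case (m_inv h)
    then have "h \<in> Units (R \<lparr>carrier := E\<rparr>)" using E.skew_field_Units by simp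
    then obtain y where y: "y \<in> E" "h \<otimes> y = \<one>" "y \<otimes> h = \<one>" by (auto simp: Units_def)
    then have "inv h = y"
      using m_inv.IH subringE(1)[OF E(1)] by (intro inv_unique'[symmetric]) auto
    with y show ?case by simp
  qed (use assms subringE[OF E(1)] in auto)
qed

definition weakly_locally_finite :: "('a, 'b) ring_scheme \<Rightarrow> bool"
  where "weakly_locally_finite R \<longleftrightarrow>
    (\<forall>S. finite S \<and> S \<subseteq> carrier R \<longrightarrow>
      centrally_finite (R \<lparr>carrier := generate_field R S\<rparr>))"

text \<open>The library defines \<^term>\<open>x\<close> to be transcendental over \<^term>\<open>K\<close> when evaluation at \<^term>\<open>x\<close>
  is injective on polynomials with coefficients in \<^term>\<open>K\<close>, and algebraic otherwise.\<close>

definition algebraic_over_center :: "('a, 'b) ring_scheme \<Rightarrow> bool"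
  where "algebraic_over_center R \<longleftrightarrow>
    (\<forall>x \<in> carrier R. \<not> ring.transcendental R (center R) x)"

text \<open>HOL cannot quantify existentially over types, so existence of a ring is asserted on a fixed
  type of elements, which should be large enough for the rings in question. This type
  contains, for instance, the formal series with real coefficients whose support lies in a free
  abelian group of countable rank (finitely supported functions from \<^typ>\<open>nat\<close> to \<^typ>\<open>int\<close>).
  The carrier of a ring may be any subset of it.\<close>

type_synonym elem = "(nat \<Rightarrow> int) \<Rightarrow> real"

end

theory Submission
  imports Defs "HOL-Algebra.Algebraic_Closure_Type" "HOL-Library.Z2"
begin

text \<open>Let \<open>K\<close> be the algebraic closure of the field with two elements, \<open>\<phi>\<close> its Frobenius automorphism
  and \<open>K\<^sub>N\<close> the finite fixed field of \<open>\<phi>^N\<close>. In the ring of twisted Laurent series over \<open>K\<close>, where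
  \<open>z a = \<phi>(a) z\<close>, let \<open>D\<close> be the union of the division rings \<open>B\<^sub>N = K\<^sub>N((z; \<phi>))\<close>, \<open>N > 0\<close>. Each
  \<open>B\<^sub>N\<close> is the centralizer of \<open>z^N\<close> in \<open>D\<close>, and it is spanned over its center by the finitely many
  \<open>c z^j\<close> with \<open>c\<close> in \<open>K\<^sub>N\<close> and \<open>0 \<le> j < N\<close>. A finite subset of \<open>D\<close> lies in some \<open>B\<^sub>N\<close>, and
  division subrings \<open>E\<close> of a centrally finite division ring \<open>B\<close> are centrally finite, because elements
  of \<open>E\<close> that are linearly independent over the center of \<open>E\<close> remain so over the center of \<open>B\<close>.
  As \<open>\<phi>\<close> has infinite order, the center of \<open>D\<close> consists of constants, over which \<open>z\<close> is
  transcendental.\<close>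

section \<open>Division subrings of centrally finite division rings\<close>

context skew_field
begin

lemma skew_inv:
  assumes "x \<in> carrier R" "x \<noteq> \<zero>"
  shows "inv x \<in> carrier R" "inv x \<otimes> x = \<one>" "x \<otimes> inv x = \<one>" "inv x \<noteq> \<zero>"
proof -
  have x: "x \<in> Units R" using assms skew_field_Units by simp
  then show "inv x \<in> carrier R" "inv x \<otimes> x = \<one>" "x \<otimes> inv x = \<one>" by simp_all
  show "inv x \<noteq> \<zero>" using Units_inv_Units[OF x] skew_field_Units by simp
qed

lemma inv_commute:
  assumes "x \<in> carrier R" "y \<in> carrier R" "x \<noteq> \<zero>" "x \<otimes> y = y \<otimes> x"
  shows "inv x \<otimes> y = y \<otimes> inv x"
proof -
  note i = skew_inv[OF assms(1,3)]
  have "inv x \<otimes> y = inv x \<otimes> (y \<otimes> x) \<otimes> inv x"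
    using assms i by (simp add: m_assoc)
  also have "\<dots> = (inv x \<otimes> x) \<otimes> y \<otimes> inv x"
    using assms(1,2) i(1) by (simp add: assms(4)[symmetric] m_assoc)
  finally show ?thesis using assms i by simp
qed

text \<open>A subring closed under \<open>inv\<close> is the division subring it generates, to which
  \<open>generate_field_skew_field\<close> applies.\<close>

lemma skew_subfieldI:
  assumes "subring K R" "\<And>x. x \<in> K \<Longrightarrow> x \<noteq> \<zero> \<Longrightarrow> inv x \<in> K"
  shows "skew_field (R\<lparr>carrier := K\<rparr>)"
proof -
  have K: "K \<subseteq> carrier R" using subringE(1)[OF assms(1)] .
  have "generate_field R K \<subseteq> K"
  proof
    fix x assume "x \<in> generate_field R K"
    then show "x \<in> K"
      by (induction rule: generate_field.induct) (use assms subringE[OF assms(1)] in auto)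
  qed
  then have "generate_field R K = K" using generate_field.incl by fast
  then show ?thesis using generate_field_skew_field(2)[OF K] by simp
qed

text \<open>\<open>generate_field R E\<close> contains the inverse and, by minimality, lies in
  \<open>E\<close>.\<close>

lemma skew_subfield_inv:
  assumes "subring E R" "skew_field (R\<lparr>carrier := E\<rparr>)" "x \<in> E" "x \<noteq> \<zero>"
  shows "inv x \<in> E"
  using generate_field_least[OF assms(1,2) order_refl] generate_field.m_inv[OF generate_field.incl, of x E]
    assms(3,4) by blast

text \<open>Makes the center a field of scalars for spans, independence and dimension.\<close>

lemma center_subfield: "subfield (center R) R"
proof -
  have sub: "subring (center R) R"
  proof (rule subringI)
    show "\<one> \<in> center R" by (auto simp: center_def)
    show "center R \<subseteq> carrier R" by (auto simp: center_def)
  next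
    fix h assume "h \<in> center R" then show "\<ominus> h \<in> center R"
      by (auto simp: center_def l_minus r_minus)
  next
    fix g h assume "g \<in> center R" "h \<in> center R"
    then have g: "g \<in> carrier R" "\<And>x. x \<in> carrier R \<Longrightarrow> g \<otimes> x = x \<otimes> g"
      and h: "h \<in> carrier R" "\<And>x. x \<in> carrier R \<Longrightarrow> h \<otimes> x = x \<otimes> h"
      by (auto simp: center_def)
    have "g \<otimes> h \<otimes> x = x \<otimes> (g \<otimes> h)" if x: "x \<in> carrier R" for x
    proof -
      have "g \<otimes> h \<otimes> x = g \<otimes> (x \<otimes> h)" using m_assoc[OF g(1) h(1) x] h(2)[OF x] by simp
      also have "\<dots> = g \<otimes> x \<otimes> h" by (rule m_assoc[OF g(1) x h(1), symmetric])
      also have "\<dots> = x \<otimes> (g \<otimes> h)" unfolding g(2)[OF x] by (rule m_assoc[OF x g(1) h(1)])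
      finally show ?thesis .
    qed
    then show "g \<otimes> h \<in> center R" using g(1) h(1) by (simp add: center_def)
    have "(g \<oplus> h) \<otimes> x = x \<otimes> (g \<oplus> h)" if x: "x \<in> carrier R" for x
      unfolding l_distr[OF g(1) h(1) x] r_distr[OF g(1) h(1) x] g(2)[OF x] h(2)[OF x] ..
    then show "g \<oplus> h \<in> center R" using g(1) h(1) by (simp add: center_def)
  qed
  have "skew_field (R\<lparr>carrier := center R\<rparr>)"
    using sub inv_commute skew_inv by (intro skew_subfieldI) (simp_all add: center_def)
  then interpret C: skew_field "R\<lparr>carrier := center R\<rparr>" .
  show ?thesis
  proof (rule subfieldI)
    show "subcring (center R) R"
    proof (rule subcringI[OF sub])
      fix g h assume "g \<in> center R" "h \<in> center R"
      then show "g \<otimes> h = h \<otimes> g" unfolding center_def by blast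
    qed
    show "Units (R\<lparr>carrier := center R\<rparr>) = center R - {\<zero>}"
      unfolding C.skew_field_Units by simp
  qed
qed

text \<open>For \<open>w = z^N\<close> this yields the division rings \<open>B\<^sub>N\<close>;
  their closure under inverses comes from \<open>inv_commute\<close>, without computing inverse
  series.\<close>

lemma centralizer_skew_subfield:
  assumes "w \<in> carrier R"
  defines "B \<equiv> {x \<in> carrier R. x \<otimes> w = w \<otimes> x}"
  shows "subring B R" and "skew_field (R\<lparr>carrier := B\<rparr>)"
proof -
  show sub: "subring B R"
  proof (rule subringI)
    show "\<one> \<in> B" "B \<subseteq> carrier R" using assms by auto
  next
    fix h assume "h \<in> B" then show "\<ominus> h \<in> B"
      using assms by (auto simp: l_minus r_minus)
  next
    fix g h assume "g \<in> B" "h \<in> B"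
    then have g: "g \<in> carrier R" "g \<otimes> w = w \<otimes> g" and h: "h \<in> carrier R" "h \<otimes> w = w \<otimes> h"
      by (auto simp: B_def)
    have "g \<otimes> h \<otimes> w = w \<otimes> (g \<otimes> h)"
      using m_assoc[of g h w] m_assoc[of g w h] m_assoc[of w g h] g h assms(1) by simp
    then show "g \<otimes> h \<in> B" using g(1) h(1) by (simp add: B_def)
    show "g \<oplus> h \<in> B" using g h assms(1) by (simp add: B_def l_distr r_distr)
  qed
  show "skew_field (R\<lparr>carrier := B\<rparr>)"
    using sub inv_commute skew_inv assms(1) by (intro skew_subfieldI) (auto simp: B_def)
qed

end

section \<open>Finite sums, linear combinations and independent lists\<close>

context ring
begin

lemma finsum_minus_distrib:
  assumes "finite I" "a \<in> I \<rightarrow> carrier R" "b \<in> I \<rightarrow> carrier R"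
  shows "(\<Oplus>i\<in>I. a i \<ominus> b i) = (\<Oplus>i\<in>I. a i) \<ominus> (\<Oplus>i\<in>I. b i)"
  using assms
proof (induction I)
  case (insert k I)
  have "a k \<in> carrier R" "b k \<in> carrier R" "finsum R a I \<in> carrier R" "finsum R b I \<in> carrier R"
    using insert by auto
  moreover have "(\<Oplus>i\<in>insert k I. a i \<ominus> b i) = (a k \<ominus> b k) \<oplus> (\<Oplus>i\<in>I. a i \<ominus> b i)"
    by (rule finsum_insert) (use insert in auto)
  moreover have "a \<in> I \<rightarrow> carrier R" "b \<in> I \<rightarrow> carrier R" using insert.prems by auto
  ultimately show ?case using insert by (simp add: minus_eq minus_add a_ac)
qed (simp add: minus_eq)

text \<open>Links the list-based linear combinations of the dimension theory with the indexed sums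
  used in the elimination arguments.\<close>

lemma combine_eq_finsum:
  assumes "length Ks = length Us" "set Ks \<subseteq> carrier R" "set Us \<subseteq> carrier R"
  shows "combine Ks Us = (\<Oplus>i\<in>{..<length Us}. Ks ! i \<otimes> Us ! i)"
  using assms
proof (induction Ks Us rule: list_induct2)
  case (Cons k Ks u Us)
  have i: "{..<length (u # Us)} = insert 0 (Suc ` {..<length Us})"
    by (simp add: lessThan_Suc_eq_insert_0)
  have nth: "Ks ! i \<otimes> Us ! i \<in> carrier R" if "i < length Us" for i
    using Cons.prems Cons.hyps that by (auto simp: subset_code(1))
  have "(\<Oplus>i\<in>Suc ` {..<length Us}. (k # Ks) ! i \<otimes> (u # Us) ! i) = (\<Oplus>i\<in>{..<length Us}. Ks ! i \<otimes> Us ! i)"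
    using nth by (subst finsum_reindex) auto
  then show ?case
    unfolding i using Cons nth by (subst finsum_insert) auto
qed simp

lemma combine_consistent:
  assumes "subring K R"
  shows "ring.combine (R\<lparr>carrier := K\<rparr>) Ks Us = combine Ks Us"
  by (induction Ks Us rule: combine.induct)
    (simp_all add: ring.combine.simps[OF subring_is_ring[OF assms]])

text \<open>In infinite dimension no finite list spans, so a vector outside the span always extends
  an independent list.\<close>

lemma long_independent_list:
  assumes "subfield K R" "\<not> finite_dimension K (carrier R)"
  shows "\<exists>Us. set Us \<subseteq> carrier R \<and> length Us = n \<and> independent K Us"
proof (induction n)
  case (Suc n)
  then obtain Us where Us: "set Us \<subseteq> carrier R" "length Us = n" "independent K Us" by blast
  have "Span K Us \<noteq> carrier R" using Span_finite_dimension[OF assms(1) Us(1)] assms(2) by metis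
  moreover have "Span K Us \<subseteq> carrier R"
    using Span_in_carrier[OF subringE(1)[OF subfieldE(1)[OF assms(1)]] Us(1)] .
  ultimately obtain u where "u \<in> carrier R" "u \<notin> Span K Us" by blast
  then show ?case using Us by (intro exI[of _ "u # Us"]) (auto intro: li_Cons)
qed auto

end

section \<open>Linear independence over the center of a division subring\<close>

context skew_field
begin

lemma mem_center_skew_subfield:
  "z \<in> center (R\<lparr>carrier := E\<rparr>) \<longleftrightarrow> z \<in> E \<and> (\<forall>x\<in>E. z \<otimes> x = x \<otimes> z)"
  by (simp add: center_def)

lemma center_skew_subfield_subring:
  assumes E: "subring E R" "skew_field (R\<lparr>carrier := E\<rparr>)"
  shows "subring (center (R\<lparr>carrier := E\<rparr>)) R"
proof -
  interpret E: skew_field "R\<lparr>carrier := E\<rparr>" by (rule E(2))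
  have C: "subring (center (R\<lparr>carrier := E\<rparr>)) (R\<lparr>carrier := E\<rparr>)"
    using E.center_subfield by (rule subfieldE)
  have ER: "x \<in> carrier R" if "x \<in> E" for x using that subringE(1)[OF E(1)] by auto
  show ?thesis
  proof (rule subringI)
    show "center (R\<lparr>carrier := E\<rparr>) \<subseteq> carrier R" using ER by (auto simp: mem_center_skew_subfield)
    show "\<one> \<in> center (R\<lparr>carrier := E\<rparr>)" using subringE(3)[OF C] by simp
    fix x y assume xy: "x \<in> center (R\<lparr>carrier := E\<rparr>)" "y \<in> center (R\<lparr>carrier := E\<rparr>)"
    show "x \<otimes> y \<in> center (R\<lparr>carrier := E\<rparr>)" "x \<oplus> y \<in> center (R\<lparr>carrier := E\<rparr>)"
      using subringE(6,7)[OF C xy] by simp_all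
  next
    \<comment> \<open>Negation, unlike sum and product, depends on the carrier, so closure is
      checked for the negation of \<open>R\<close> itself.\<close>
    fix x assume "x \<in> center (R\<lparr>carrier := E\<rparr>)"
    then show "\<ominus> x \<in> center (R\<lparr>carrier := E\<rparr>)"
      using subringE(5)[OF E(1)] ER by (simp add: mem_center_skew_subfield l_minus r_minus)
  qed
qed

text \<open>Normalizing one coefficient to \<open>1\<close> and taking commutators with elements of \<^term>\<open>E\<close> shortens
  the relation until all its coefficients are central in \<^term>\<open>E\<close>.\<close>

lemma subfield_relation_of_skew_relation:
  assumes E: "subring E R" "skew_field (R\<lparr>carrier := E\<rparr>)"
    and "finite I" "e \<in> I \<rightarrow> E" "f \<in> I \<rightarrow> carrier R"
    and comm: "\<And>i x. i \<in> I \<Longrightarrow> x \<in> E \<Longrightarrow> f i \<otimes> x = x \<otimes> f i"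
    and "(\<Oplus>i\<in>I. e i \<otimes> f i) = \<zero>" "\<exists>k\<in>I. e k \<noteq> \<zero>"
  shows "\<exists>c \<in> I \<rightarrow> center (R\<lparr>carrier := E\<rparr>). (\<Oplus>i\<in>I. c i \<otimes> f i) = \<zero> \<and> (\<exists>k\<in>I. c k \<noteq> \<zero>)"
  using assms(3-)
proof (induction I arbitrary: e)
  case empty
  then show ?case by simp
next
  case (insert k I)
  let ?C = "center (R\<lparr>carrier := E\<rparr>)"
  have ER: "x \<in> carrier R" if "x \<in> E" for x using that subringE(1)[OF E(1)] by auto
  note C = mem_center_skew_subfield[of _ E]
  note zero = subringE(2)[OF center_skew_subfield_subring[OF E]]
  have e: "e i \<in> E" "e i \<in> carrier R" and f: "f i \<in> carrier R" if "i \<in> insert k I" for i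
    using that insert.prems ER by auto
  have ek: "e k \<in> carrier R" and fk: "f k \<in> carrier R" using e f by auto
  have ins: "(\<Oplus>i\<in>insert k I. c i \<otimes> f i) = c k \<otimes> f k \<oplus> (\<Oplus>i\<in>I. c i \<otimes> f i)"
    if "c \<in> insert k I \<rightarrow> carrier R" for c
    by (rule finsum_insert) (use that insert.hyps f in auto)
  \<comment> \<open>A relation on the smaller index set extends by the coefficient zero at
    \<open>k\<close>.\<close>
  have lift: ?case
    if c: "c \<in> I \<rightarrow> ?C" "(\<Oplus>i\<in>I. c i \<otimes> f i) = \<zero>" "\<exists>k\<in>I. c k \<noteq> \<zero>" for c
  proof -
    let ?c = "\<lambda>i. if i = k then \<zero> else c i"
    have cC: "?c \<in> insert k I \<rightarrow> ?C"
      using c(1) zero by auto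
    have cI: "c i \<in> carrier R" if "i \<in> I" for i using that c(1) ER C by blast
    have "(\<Oplus>i\<in>I. ?c i \<otimes> f i) = (\<Oplus>i\<in>I. c i \<otimes> f i)"
      using insert.hyps f cI by (intro finsum_cong') auto
    moreover have "(\<Oplus>i\<in>insert k I. ?c i \<otimes> f i) = \<zero> \<otimes> f k \<oplus> (\<Oplus>i\<in>I. ?c i \<otimes> f i)"
      using cI by (subst ins) auto
    ultimately have "(\<Oplus>i\<in>insert k I. ?c i \<otimes> f i) = \<zero>" using c(2) fk by simp
    moreover have "\<exists>j\<in>insert k I. ?c j \<noteq> \<zero>" using c(3) insert.hyps by auto
    ultimately show ?thesis using cC by (intro bexI[of _ ?c] conjI)
  qed
  show ?case
  proof (cases "e k = \<zero>")
    case True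
    have "\<exists>j\<in>I. e j \<noteq> \<zero>" using insert.prems True by auto
    moreover have "(\<Oplus>i\<in>I. e i \<otimes> f i) = \<zero>"
    proof -
      have "(\<Oplus>i\<in>I. e i \<otimes> f i) \<in> carrier R" using e f by (intro finsum_closed) auto
      then show ?thesis using insert.prems(4) ins[of e] e True fk by auto
    qed
    ultimately show ?thesis using insert.IH[of e] insert.prems lift by blast
  next
    case False
    note ik = skew_inv[OF ek False]
    define d where "d i = inv (e k) \<otimes> e i" for i
    have dE: "d i \<in> E" if "i \<in> insert k I" for i
      unfolding d_def using skew_subfield_inv[OF E _ False] e that subringE(6)[OF E(1)] by auto
    then have dR: "d i \<in> carrier R" if "i \<in> insert k I" for i using that ER by blast
    have dk: "d k = \<one>" using ik by (simp add: d_def)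
    have dsum: "(\<Oplus>i\<in>insert k I. d i \<otimes> f i) = \<zero>"
    proof -
      have "inv (e k) \<otimes> (\<Oplus>i\<in>insert k I. e i \<otimes> f i) = (\<Oplus>i\<in>insert k I. inv (e k) \<otimes> (e i \<otimes> f i))"
        using insert.hyps e f ik by (intro finsum_rdistr) auto
      also have "\<dots> = (\<Oplus>i\<in>insert k I. d i \<otimes> f i)"
        using e f ik dR by (intro finsum_cong') (auto simp: d_def m_assoc)
      finally show ?thesis using insert.prems(4) ik by simp
    qed
    show ?thesis
    proof (cases "\<forall>i\<in>I. d i \<in> ?C")
      case True
      moreover have "d k \<in> ?C" using dE[of k] ER by (auto simp: C dk)
      ultimately have "d \<in> insert k I \<rightarrow> ?C" by auto
      then show ?thesis using dsum dk one_not_zero by auto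
    next
      case False
      then obtain j x where j: "j \<in> I" and x: "x \<in> E" and ne: "d j \<otimes> x \<noteq> x \<otimes> d j"
        using dE by (auto simp: C)
      have xR: "x \<in> carrier R" using x ER by blast
      \<comment> \<open>Because \<open>f i\<close> commutes with \<open>x\<close>, the relation with
        coefficients \<open>b\<close> is the commutator of \<open>x\<close> with the relation for
        \<open>d\<close>. It loses the index \<open>k\<close>, where \<open>d k = 1\<close>, but
        stays nontrivial at \<open>j\<close>.\<close>
      define b where "b i = x \<otimes> d i \<ominus> d i \<otimes> x" for i
      have bE: "b i \<in> E" if "i \<in> insert k I" for i
        using dE[OF that] x subringE(5,6,7)[OF E(1)] by (auto simp: b_def minus_eq)
      then have bR: "b i \<in> carrier R" if "i \<in> insert k I" for i using that ER by blast
      have bf: "b i \<otimes> f i = x \<otimes> (d i \<otimes> f i) \<ominus> (d i \<otimes> f i) \<otimes> x" if "i \<in> insert k I" for i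
      proof -
        have "f i \<otimes> x = x \<otimes> f i" using insert.prems(3)[OF that x] .
        then show ?thesis
          using dR[OF that] f[OF that] xR
          by (simp add: b_def minus_eq l_distr l_minus m_assoc)
      qed
      have "(\<Oplus>i\<in>insert k I. b i \<otimes> f i)
          = (\<Oplus>i\<in>insert k I. x \<otimes> (d i \<otimes> f i) \<ominus> (d i \<otimes> f i) \<otimes> x)"
        using bf dR f xR by (intro finsum_cong') auto
      also have "\<dots> = (\<Oplus>i\<in>insert k I. x \<otimes> (d i \<otimes> f i)) \<ominus> (\<Oplus>i\<in>insert k I. (d i \<otimes> f i) \<otimes> x)"
        using insert.hyps dR f xR by (intro finsum_minus_distrib) auto
      also have "\<dots> = x \<otimes> (\<Oplus>i\<in>insert k I. d i \<otimes> f i) \<ominus> (\<Oplus>i\<in>insert k I. d i \<otimes> f i) \<otimes> x"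
        using insert.hyps dR f xR by (subst finsum_rdistr, simp, simp, force, subst finsum_ldistr) auto
      also have "\<dots> = \<zero>" using dsum xR by (simp add: minus_eq)
      finally have "(\<Oplus>i\<in>insert k I. b i \<otimes> f i) = \<zero>" .
      moreover have "b k = \<zero>" using xR by (simp add: b_def dk minus_eq r_neg)
      moreover have "(\<Oplus>i\<in>I. b i \<otimes> f i) \<in> carrier R" using bR f by (intro finsum_closed) auto
      ultimately have "(\<Oplus>i\<in>I. b i \<otimes> f i) = \<zero>" using ins[of b] bR fk by auto
      moreover have "b j \<noteq> \<zero>"
        using ne dR[of j] j xR by (auto simp: b_def)
      ultimately show ?thesis
        using insert.IH[of b] insert.prems(2,3) bE j lift by blast
    qed
  qed
qed

text \<open>Independence is stated for indexed families, so that an induction can remove an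
  arbitrary index; the scalars act from the left.\<close>

definition lin_indep :: "'a set \<Rightarrow> 'i set \<Rightarrow> ('i \<Rightarrow> 'a) \<Rightarrow> bool"
  where "lin_indep K I e \<longleftrightarrow>
    (\<forall>c \<in> I \<rightarrow> K. (\<Oplus>i\<in>I. c i \<otimes> e i) = \<zero> \<longrightarrow> (\<forall>i\<in>I. c i = \<zero>))"

text \<open>In a relation \<open>\<Sum> f i * e i = 0\<close> the \<open>f i\<close> are dependent over the center of \<^term>\<open>E\<close> by the
  previous lemma; eliminating one of them leaves a shorter relation whose new \<open>e i\<close> are still
  independent.\<close>

lemma lin_indep_commuting:
  assumes E: "subring E R" "skew_field (R\<lparr>carrier := E\<rparr>)"
    and "finite I" "e \<in> I \<rightarrow> E" "lin_indep (center (R\<lparr>carrier := E\<rparr>)) I e"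
    and "f \<in> I \<rightarrow> carrier R"
    and "\<And>i x. i \<in> I \<Longrightarrow> x \<in> E \<Longrightarrow> f i \<otimes> x = x \<otimes> f i"
    and "(\<Oplus>i\<in>I. f i \<otimes> e i) = \<zero>"
  shows "\<forall>i\<in>I. f i = \<zero>"
  using assms(3-)
proof (induction "card I" arbitrary: I e)
  case 0
  then show ?case by simp
next
  case (Suc n)
  let ?C = "center (R\<lparr>carrier := E\<rparr>)"
  note Csub = center_skew_subfield_subring[OF E]
  note C = mem_center_skew_subfield[of _ E]
  note zero = subringE(2)[OF Csub] and Cminus = subringE(5)[OF Csub]
    and Cmult = subringE(6)[OF Csub] and Cadd = subringE(7)[OF Csub]
  have ER: "x \<in> carrier R" if "x \<in> E" for x using that subringE(1)[OF E(1)] by auto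
  have CR: "x \<in> carrier R" if "x \<in> ?C" for x using that ER by (simp add: C)
  have Csum: "(\<Oplus>i\<in>J. g i) \<in> ?C" if "finite J" "g \<in> J \<rightarrow> ?C" for J g
    using that
  proof (induction J)
    case (insert j J)
    then have "(\<Oplus>i\<in>insert j J. g i) = g j \<oplus> (\<Oplus>i\<in>J. g i)"
      using CR by (intro finsum_insert) auto
    then show ?case using insert Cadd by auto
  qed (simp add: zero)
  have e: "e i \<in> E" "e i \<in> carrier R" and f: "f i \<in> carrier R" if "i \<in> I" for i
    using that Suc.prems(2,4) ER by blast+
  have fe: "f i \<otimes> e i = e i \<otimes> f i" if "i \<in> I" for i using that Suc.prems(5) e by blast
  \<comment> \<open>The relation lemma needs a nonzero coefficient. If all \<open>e i\<close>
    vanished, the constant coefficient one would violate independence, as \<open>I\<close> is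
    nonempty.\<close>
  have one: "\<exists>k\<in>I. e k \<noteq> \<zero>"
  proof (rule ccontr)
    assume "\<not> (\<exists>k\<in>I. e k \<noteq> \<zero>)"
    then have "(\<Oplus>i\<in>I. \<one> \<otimes> e i) = (\<Oplus>i\<in>I. \<zero>)" by (intro finsum_cong') auto
    then have "(\<Oplus>i\<in>I. \<one> \<otimes> e i) = \<zero>" by simp
    moreover have "\<one> \<in> ?C" using subringE(3)[OF Csub] by simp
    ultimately have "\<forall>i\<in>I. \<one> = \<zero>" using Suc.prems(3) unfolding lin_indep_def by (auto dest: bspec[of _ _ "\<lambda>_. \<one>"])
    then show False using one_not_zero Suc.hyps(2) by auto
  qed
  \<comment> \<open>With the factors swapped, the hypothesis is a relation among the
    \<open>f i\<close> with coefficients \<open>e i\<close> in \<open>E\<close>, so the previous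
    lemma provides coefficients that are central in \<open>E\<close>.\<close>
  have "(\<Oplus>i\<in>I. e i \<otimes> f i) = (\<Oplus>i\<in>I. f i \<otimes> e i)"
    using fe e f by (intro finsum_cong') auto
  then obtain c0 k where c0: "c0 \<in> I \<rightarrow> ?C" "(\<Oplus>i\<in>I. c0 i \<otimes> f i) = \<zero>" and k: "k \<in> I" "c0 k \<noteq> \<zero>"
    using subfield_relation_of_skew_relation[OF E Suc.prems(1,2,4,5) _ one] Suc.prems(6) by auto
  define c where "c i = inv (c0 k) \<otimes> c0 i" for i
  have c0k: "c0 k \<in> ?C" "c0 k \<in> E" using c0 k C by auto
  note ik = skew_inv[OF CR[OF c0k(1)] k(2)]
  have inv: "inv (c0 k) \<in> ?C"
    using skew_subfield_inv[OF E c0k(2) k(2)] inv_commute[OF CR[OF c0k(1)] ER k(2)] c0k(1)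
    by (auto simp: C)
  have c: "c i \<in> ?C" if "i \<in> I" for i
    using that c0(1) inv Cmult by (auto simp: c_def)
  have c': "c i \<in> carrier R" if "i \<in> I" for i using c[OF that] CR by blast
  have ck: "c k = \<one>" using ik by (simp add: c_def)
  have csum: "(\<Oplus>i\<in>I. c i \<otimes> f i) = \<zero>"
  proof -
    have "inv (c0 k) \<otimes> (\<Oplus>i\<in>I. c0 i \<otimes> f i) = (\<Oplus>i\<in>I. inv (c0 k) \<otimes> (c0 i \<otimes> f i))"
      using Suc.prems(1) c0(1) f ik CR by (intro finsum_rdistr) auto
    also have "\<dots> = (\<Oplus>i\<in>I. c i \<otimes> f i)"
      using c0(1) f ik CR c' by (intro finsum_cong') (auto simp: c_def m_assoc Pi_def)
    finally show ?thesis using c0(2) ik by simp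
  qed
  let ?I = "I - {k}"
  have I: "I = insert k ?I" "k \<notin> ?I" "finite ?I" using k Suc.prems(1) by auto
  have split: "(\<Oplus>i\<in>I. g i) = g k \<oplus> (\<Oplus>i\<in>?I. g i)" if "g \<in> I \<rightarrow> carrier R" for g
    by (subst I(1), rule finsum_insert) (use that I k in auto)
  \<comment> \<open>Now \<open>f k\<close> is minus the sum of the other
    \<open>c i \<otimes> f i\<close>; substituting this into the given relation turns each remaining
    \<open>e i\<close> into \<open>e' i\<close>.\<close>
  define e' where "e' i = e i \<ominus> c i \<otimes> e k" for i
  have ek: "e k \<in> carrier R" "e k \<in> E" and fk: "f k \<in> carrier R" using e f k by auto
  have e'E: "e' i \<in> E" if "i \<in> ?I" for i
    using that e ek c subringE(5,6,7)[OF E(1)] by (auto simp: e'_def minus_eq C)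
  have e'sum: "(\<Oplus>i\<in>?I. b i \<otimes> e' i) = (\<Oplus>i\<in>?I. b i \<otimes> e i) \<ominus> (\<Oplus>i\<in>?I. b i \<otimes> c i) \<otimes> e k"
    if b: "b \<in> ?I \<rightarrow> carrier R" for b
  proof -
    have b: "b i \<in> carrier R" if "i \<in> ?I" for i using b that by auto
    have "(\<Oplus>i\<in>?I. b i \<otimes> e' i) = (\<Oplus>i\<in>?I. b i \<otimes> e i \<ominus> (b i \<otimes> c i) \<otimes> e k)"
      using b e c' ek by (intro finsum_cong') (auto simp: e'_def minus_eq r_distr r_minus m_assoc)
    also have "\<dots> = (\<Oplus>i\<in>?I. b i \<otimes> e i) \<ominus> (\<Oplus>i\<in>?I. (b i \<otimes> c i) \<otimes> e k)"
      using b e c' ek I by (intro finsum_minus_distrib) auto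
    finally show ?thesis using b c' ek I by (subst finsum_ldistr) auto
  qed
  have "(\<Oplus>i\<in>?I. f i \<otimes> e' i) = \<zero>"
  proof -
    have "(\<Oplus>i\<in>?I. f i \<otimes> c i) = (\<Oplus>i\<in>?I. c i \<otimes> f i)"
    proof (rule finsum_cong')
      show "f i \<otimes> c i = c i \<otimes> f i" if "i \<in> ?I" for i
        using that Suc.prems(5)[of i "c i"] c[of i] by (simp add: C)
    qed (use c' f in auto)
    moreover have "f k \<oplus> (\<Oplus>i\<in>?I. c i \<otimes> f i) = \<zero>"
      using split[of "\<lambda>i. c i \<otimes> f i"] csum c' f fk by (auto simp: ck)
    moreover have S: "(\<Oplus>i\<in>?I. c i \<otimes> f i) \<in> carrier R" "(\<Oplus>i\<in>?I. f i \<otimes> e i) \<in> carrier R"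
      using c' f e by (auto intro!: finsum_closed)
    ultimately have "(\<Oplus>i\<in>?I. f i \<otimes> c i) = \<ominus> f k" using fk by (metis minus_equality a_comm)
    moreover have "f k \<otimes> e k \<oplus> (\<Oplus>i\<in>?I. f i \<otimes> e i) = \<zero>"
      using split[of "\<lambda>i. f i \<otimes> e i"] Suc.prems(6) f e by auto
    ultimately show ?thesis
      using e'sum[of f] f fk ek S by (auto simp: minus_eq l_minus a_comm)
  qed
  moreover have "lin_indep ?C ?I e'"
    unfolding lin_indep_def
  proof (intro ballI impI)
    fix b i assume b: "b \<in> ?I \<rightarrow> ?C" and z: "(\<Oplus>i\<in>?I. b i \<otimes> e' i) = \<zero>" and i: "i \<in> ?I"
    \<comment> \<open>A relation among the \<open>e' i\<close> becomes one among the
      \<open>e i\<close>, with coefficient \<open>\<ominus> ?s\<close> at \<open>k\<close>.\<close>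
    let ?s = "(\<Oplus>i\<in>?I. b i \<otimes> c i)"
    let ?b = "\<lambda>i. if i = k then \<ominus> ?s else b i"
    have bC: "b i \<in> ?C" if "i \<in> ?I" for i using b that by blast
    have s: "?s \<in> ?C" using bC c I(3) Cmult by (intro Csum Pi_I) auto
    have b': "b i \<in> carrier R" if "i \<in> ?I" for i using b CR that by auto
    have be: "(\<Oplus>i\<in>?I. b i \<otimes> e i) \<in> carrier R" using b' e by (auto intro!: finsum_closed)
    have "(\<Oplus>i\<in>I. ?b i \<otimes> e i) = (\<ominus> ?s) \<otimes> e k \<oplus> (\<Oplus>i\<in>?I. ?b i \<otimes> e i)"
      using b' e CR[OF s] by (subst split) auto
    also have "(\<Oplus>i\<in>?I. ?b i \<otimes> e i) = (\<Oplus>i\<in>?I. b i \<otimes> e i)"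
      using b' e by (intro finsum_cong') auto
    also have "(\<ominus> ?s) \<otimes> e k \<oplus> (\<Oplus>i\<in>?I. b i \<otimes> e i) = \<zero>"
      using e'sum[of b] b' z be CR[OF s] ek by (simp add: minus_eq l_minus a_comm)
    finally have "(\<Oplus>i\<in>I. ?b i \<otimes> e i) = \<zero>" .
    moreover have "?b \<in> I \<rightarrow> ?C" using bC s Cminus by auto
    ultimately have "\<forall>i\<in>I. ?b i = \<zero>"
      using Suc.prems(3) unfolding lin_indep_def by (auto dest!: bspec[of _ _ ?b])
    then have "?b i = \<zero>" using i by blast
    then show "b i = \<zero>" using i by auto
  qed
  moreover have "n = card ?I" using Suc.hyps(2) k by simp
  ultimately have "\<forall>i\<in>?I. f i = \<zero>"
    using e'E Suc.prems(4,5) by (intro Suc.hyps(1)[of ?I e'] I(3)) (auto simp del: Pi_split_insert_domain)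
  note rest = this
  \<comment> \<open>With the other \<open>f i\<close> zero, the relation normalized by
    \<open>c k = \<one>\<close> reduces to \<open>f k = \<zero>\<close>.\<close>
  have "(\<Oplus>i\<in>?I. c i \<otimes> f i) = (\<Oplus>i\<in>?I. \<zero>)"
    using rest c' by (intro finsum_cong') auto
  moreover have "(\<Oplus>i\<in>I. c i \<otimes> f i) = c k \<otimes> f k \<oplus> (\<Oplus>i\<in>?I. c i \<otimes> f i)"
    using c' f by (intro split) auto
  ultimately have "f k = \<zero>" using csum fk by (simp add: ck)
  then show ?case using rest by blast
qed

lemma independent_if_lin_indep:
  assumes K: "subfield K R" and Us: "set Us \<subseteq> carrier R"
    and indep: "lin_indep K {..<length Us} (\<lambda>i. Us ! i)"
  shows "independent K Us"
proof (rule trivial_combine_imp_independent[OF K Us])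
  fix Ks assume Ks: "set Ks \<subseteq> K" and zero: "combine Ks Us = \<zero>"
  have KR: "K \<subseteq> carrier R" using subringE(1)[OF subfieldE(1)[OF K]] .
  have "set Ks \<subseteq> carrier R" using Ks KR by blast
  \<comment> \<open>A coefficient list may be shorter or longer than \<open>Us\<close>;
    \<open>Ls\<close> is its padding with zeros or its truncation.\<close>
  then obtain Ls where Ls: "set (take (length Us) Ks) \<subseteq> set Ls"
      "set Ls \<subseteq> set (take (length Us) Ks) \<union> {\<zero>}" "length Ls = length Us" "combine Ls Us = \<zero>"
    using combine_normalize[OF _ Us zero] by metis
  have LsK: "set Ls \<subseteq> K"
    using Ls(2) Ks set_take_subset[of "length Us" Ks] subringE(2)[OF subfieldE(1)[OF K]] by blast
  have "(\<Oplus>i\<in>{..<length Us}. Ls ! i \<otimes> Us ! i) = \<zero>"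
    using combine_eq_finsum[OF Ls(3) _ Us] LsK KR Ls(4) by auto
  moreover have "(\<lambda>i. Ls ! i) \<in> {..<length Us} \<rightarrow> K"
    using LsK Ls(3) by (auto simp: subset_code(1))
  ultimately have "\<forall>i\<in>{..<length Us}. Ls ! i = \<zero>"
    using indep unfolding lin_indep_def by blast
  then have "set Ls \<subseteq> {\<zero>}" using Ls(3) by (auto simp: in_set_conv_nth)
  then show "set (take (length Us) Ks) \<subseteq> {\<zero>}" using Ls(1) by blast
qed

text \<open>Elements of the center of \<open>R\<close> commute with \<open>E\<close>, so by
  \<open>lin_indep_commuting\<close> a list in \<open>E\<close> that is independent over the center
  of \<open>E\<close> is independent over the center of \<open>R\<close>. The dimension of
  \<open>R\<close> over its center therefore bounds its length.\<close>

lemma centrally_finite_skew_subfield: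
  assumes fin: "centrally_finite R" and E: "subring E R" "skew_field (R\<lparr>carrier := E\<rparr>)"
  shows "centrally_finite (R\<lparr>carrier := E\<rparr>)"
proof (rule ccontr)
  interpret E: skew_field "R\<lparr>carrier := E\<rparr>" by (rule E(2))
  let ?C = "center (R\<lparr>carrier := E\<rparr>)"
  assume "\<not> centrally_finite (R\<lparr>carrier := E\<rparr>)"
  then have inf: "\<not> E.finite_dimension ?C E" by (simp add: centrally_finite_def)
  obtain d where d: "dimension d (center R) (carrier R)"
    using fin unfolding centrally_finite_def finite_dimension_def by blast
  obtain Us where Us: "set Us \<subseteq> E" "length Us = Suc d" "E.independent ?C Us"
    using E.long_independent_list[OF E.center_subfield, of "Suc d"] inf by auto
  have ER: "E \<subseteq> carrier R" using subringE(1)[OF E(1)] .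
  then have UsR: "set Us \<subseteq> carrier R" using Us(1) by blast
  have CE: "?C \<subseteq> E" by (auto simp: center_def)
  have li: "lin_indep ?C {..<length Us} (\<lambda>i. Us ! i)"
    unfolding lin_indep_def
  proof (intro ballI impI)
    fix c i assume c: "c \<in> {..<length Us} \<rightarrow> ?C" and z: "(\<Oplus>i\<in>{..<length Us}. c i \<otimes> Us ! i) = \<zero>"
      and i: "i \<in> {..<length Us}"
    let ?Ks = "map c [0..<length Us]"
    have cU: "c i \<otimes> Us ! i \<in> carrier R" if "i < length Us" for i
      using that c CE ER UsR nth_mem[OF that] by blast
    have Ks: "set ?Ks \<subseteq> ?C" using c by auto
    have "combine ?Ks Us = (\<Oplus>i\<in>{..<length Us}. ?Ks ! i \<otimes> Us ! i)"
      using Ks CE ER UsR by (intro combine_eq_finsum) auto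
    also have "\<dots> = (\<Oplus>i\<in>{..<length Us}. c i \<otimes> Us ! i)"
      using cU by (intro finsum_cong') auto
    finally have "E.combine ?Ks Us = \<zero>" using z combine_consistent[OF E(1)] by simp
    then have "set (take (length Us) ?Ks) \<subseteq> {\<zero>}"
      using E.independent_imp_trivial_combine[OF E.center_subfield Us(3) Ks] by simp
    then have "c ` {..<length Us} \<subseteq> {\<zero>}" by (simp add: atLeast0LessThan)
    then show "c i = \<zero>" using i by blast
  qed
  have "lin_indep (center R) {..<length Us} (\<lambda>i. Us ! i)"
    unfolding lin_indep_def
  proof (intro ballI impI)
    fix f i assume f: "f \<in> {..<length Us} \<rightarrow> center R"
      and z: "(\<Oplus>i\<in>{..<length Us}. f i \<otimes> Us ! i) = \<zero>" and i: "i \<in> {..<length Us}"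
    have "\<forall>i\<in>{..<length Us}. f i = \<zero>"
    proof (rule lin_indep_commuting[OF E _ _ li _ _ z])
      show "f \<in> {..<length Us} \<rightarrow> carrier R" using f by (auto simp: center_def)
      show "f i \<otimes> x = x \<otimes> f i" if "i \<in> {..<length Us}" "x \<in> E" for i x
        using f that ER unfolding center_def by blast
    qed (use Us in auto)
    then show "f i = \<zero>" using i by blast
  qed
  then have "independent (center R) Us"
    by (rule independent_if_lin_indep[OF center_subfield UsR])
  then have "length Us \<le> d"
    using independent_length_le_dimension[OF center_subfield d] UsR by blast
  then show False using Us(2) by simp
qed

text \<open>Enumerating \<open>U\<close> as a list exhibits the carrier as the span of finitely many
  elements.\<close>

lemma centrally_finiteI:
  assumes "finite U" "u \<in> U \<rightarrow> carrier R"
    and "\<And>x. x \<in> carrier R \<Longrightarrow> \<exists>a \<in> U \<rightarrow> center R. x = (\<Oplus>i\<in>U. a i \<otimes> u i)"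
  shows "centrally_finite R"
proof -
  obtain Is where Is: "set Is = U" using finite_list[OF assms(1)] by blast
  let ?Us = "map u Is" and ?S = "Span (center R) (map u Is)"
  have Us: "set ?Us \<subseteq> carrier R" using assms(2) Is by auto
  note S = Span_subgroup_props[OF center_subfield Us]
  have "(\<Oplus>i\<in>V. a i \<otimes> u i) \<in> ?S" if "a \<in> U \<rightarrow> center R" "V \<subseteq> U" for a V
  proof -
    have "finite V" using that assms(1) finite_subset by blast
    then show ?thesis using that(2)
    proof (induction V)
      case (insert j V)
      have mem: "a i \<otimes> u i \<in> ?S" if "i \<in> U" for i
      proof (rule Span_smult_closed[OF center_subfield Us])
        show "a i \<in> center R" using \<open>a \<in> U \<rightarrow> center R\<close> that by blast
        show "u i \<in> ?S" using Span_base_incl[OF center_subfield Us] that Is by auto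
      qed
      have "(\<Oplus>i\<in>insert j V. a i \<otimes> u i) = a j \<otimes> u j \<oplus> (\<Oplus>i\<in>V. a i \<otimes> u i)"
        using insert mem S(1) by (intro finsum_insert) blast+
      then show ?case using insert mem S(3) by auto
    qed (use S(2) in simp)
  qed
  then have "carrier R \<subseteq> ?S" using assms(3) by blast
  then have "?S = carrier R" using S(1) by blast
  then show ?thesis
    using Span_finite_dimension[OF center_subfield Us] by (simp add: centrally_finite_def)
qed

end

section \<open>Twisted Laurent series\<close>

text \<open>These are the powers of a single field automorphism: \<open>act (- i)\<close> inverts
  \<open>act i\<close>, and preservation of 0 and 1 follows.\<close>

locale field_int_action =
  fixes act :: "int \<Rightarrow> 'a::field \<Rightarrow> 'a"
  assumes act_zero_left: "act 0 a = a"
    and act_add_left: "act (i + j) a = act i (act j a)"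
    and act_add: "act i (a + b) = act i a + act i b"
    and act_mult: "act i (a * b) = act i a * act i b"
begin

lemma act_0 [simp]: "act i 0 = 0"
  using act_add[of i 0 0] by (metis add.right_neutral add_left_cancel)

lemma act_eq_iff: "act i a = act i b \<longleftrightarrow> a = b"
  by (metis act_add_left act_zero_left left_minus)

lemma act_1 [simp]: "act i 1 = 1"
  using act_mult[of i 1 1] act_eq_iff[of i 1 0] by simp

lemma act_commute: "act i (act j a) = act j (act i a)"
  by (metis act_add_left add.commute)

lemma act_sum: "act i (sum f A) = (\<Sum>x\<in>A. act i (f x))"
  by (induction A rule: infinite_finite_induct) (simp_all add: act_add)

lemma act_minus: "act i (- a) = - act i a"
  using act_add[of i a "- a"] by (simp add: eq_neg_iff_add_eq_0 add.commute)

lemma act_diff: "act i (a - b) = act i a - act i b"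
  using act_add[of i a "- b"] by (simp add: act_minus)

lemma act_divide: "act i (a / b) = act i a / act i b"
proof (cases "b = 0")
  case False
  then have "act i b \<noteq> 0" using act_eq_iff[of i b 0] by simp
  moreover have "act i (a / b) * act i b = act i a" using False act_mult[of i "a / b" b] by simp
  ultimately show ?thesis by (simp add: field_simps)
qed simp

lemma act_fixed_mult:
  assumes "act N a = a"
  shows "act (int k * N) a = a"
proof (induction k)
  case (Suc k)
  have "act (int (Suc k) * N) a = act (int k * N) (act N a)"
    by (subst act_add_left[symmetric]) (simp add: algebra_simps)
  then show ?case using assms Suc by simp
qed (simp add: act_zero_left)

text \<open>The exponents fixing a given element form a subgroup of the integers. Hence two periods
  can be replaced by their product, and \<open>z^i\<close> with \<open>N dvd i\<close> commutes with
  the coefficients fixed by \<open>act N\<close>.\<close>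

lemma act_fixed_dvd:
  assumes "act N a = a" "N dvd M"
  shows "act M a = a"
proof -
  have neg: "act (- i) a = a" if "act i a = a" for i
    using act_add_left[of "- i" i a] that by (simp add: act_zero_left)
  obtain k where k: "M = N * k" using assms(2) by (auto elim: dvdE)
  show ?thesis
  proof (cases "k \<ge> 0")
    case True
    then show ?thesis using act_fixed_mult[OF assms(1), of "nat k"] by (simp add: k mult.commute)
  next
    case False
    then show ?thesis
      using neg[OF act_fixed_mult[OF assms(1), of "nat (- k)"]] by (simp add: k mult.commute)
  qed
qed

text \<open>The series \<open>\<Sum>n. f n * z^n\<close>; the second condition confines the coefficients of \<^term>\<open>f\<close>
  to the fixed field of a nontrivial power of the action.\<close>

definition series :: "(int \<Rightarrow> 'a) set"
  where "series = {f. (\<exists>m. \<forall>n<m. f n = 0) \<and> (\<exists>N>0. \<forall>n. act N (f n) = f n)}"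

text \<open>Multiplication of series subject to the commutation rule \<open>z^i * a = act i a * z^i\<close>.\<close>

definition conv :: "(int \<Rightarrow> 'a) \<Rightarrow> (int \<Rightarrow> 'a) \<Rightarrow> int \<Rightarrow> 'a"
  where "conv f g n = (\<Sum>i | f i \<noteq> 0 \<and> g (n - i) \<noteq> 0. f i * act i (g (n - i)))"

definition monomial :: "'a \<Rightarrow> int \<Rightarrow> int \<Rightarrow> 'a"
  where "monomial c k n = (if n = k then c else 0)"

section \<open>Arithmetic of twisted series\<close>

lemma seriesE:
  assumes "f \<in> series"
  obtains m N where "\<forall>n<m. f n = 0" "N > 0" "\<forall>n. act N (f n) = f n"
  using assms unfolding series_def by blast

lemma seriesI:
  assumes "\<forall>n<m. f n = 0" "N > 0" "\<forall>n. act N (f n) = f n"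
  shows "f \<in> series"
  using assms unfolding series_def by blast

lemma conv_eq:
  assumes "finite A" "\<And>i. f i \<noteq> 0 \<Longrightarrow> g (n - i) \<noteq> 0 \<Longrightarrow> i \<in> A"
  shows "conv f g n = (\<Sum>i\<in>A. f i * act i (g (n - i)))"
  unfolding conv_def using assms by (intro sum.mono_neutral_left) auto

text \<open>A nonzero summand needs \<open>p \<le> i\<close> and \<open>q \<le> n - i\<close>. The
  slack in \<open>p'\<close> and \<open>s\<close> lets different coefficients be summed over a
  common range.\<close>

lemma conv_bound:
  assumes "\<forall>i<p. f i = 0" "\<forall>i<q. g i = 0" "p' \<le> p" "n - q \<le> s"
  shows "conv f g n = (\<Sum>i\<in>{p'..s}. f i * act i (g (n - i)))"
proof (rule conv_eq)
  fix i assume "f i \<noteq> 0" "g (n - i) \<noteq> 0"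
  then have "\<not> i < p" "\<not> n - i < q" using assms by blast+
  then show "i \<in> {p'..s}" using assms by auto
qed simp

lemma conv_low:
  assumes "\<forall>i<p. f i = 0" "\<forall>i<q. g i = 0"
  shows "\<forall>n<p + q. conv f g n = 0"
  using conv_bound[OF assms order_refl order_refl] by simp

lemma common_period:
  assumes "f \<in> series" "g \<in> series"
  obtains N where "N > 0" "\<forall>n. act N (f n) = f n" "\<forall>n. act N (g n) = g n"
proof -
  obtain N where N: "N > 0" "\<forall>n. act N (f n) = f n" by (rule seriesE[OF assms(1)])
  obtain M where M: "M > 0" "\<forall>n. act M (g n) = g n" by (rule seriesE[OF assms(2)])
  have "N * M > 0" using N(1) M(1) by simp
  then show thesis using that[of "N * M"] N(2) M(2) act_fixed_dvd by (metis dvd_triv_left dvd_triv_right)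
qed

text \<open>\<open>act N\<close> is a field automorphism commuting with every \<open>act i\<close>,
  so it passes through the sum to the coefficients.\<close>

lemma conv_fixed:
  assumes "\<forall>n. act N (f n) = f n" "\<forall>n. act N (g n) = g n"
  shows "act N (conv f g n) = conv f g n"
  unfolding conv_def by (simp add: act_sum act_mult act_commute[of N] assms)

lemma conv_series:
  assumes "f \<in> series" "g \<in> series"
  shows "conv f g \<in> series"
proof -
  obtain p where p: "\<forall>i<p. f i = 0" by (rule seriesE[OF assms(1)])
  obtain q where q: "\<forall>i<q. g i = 0" by (rule seriesE[OF assms(2)])
  obtain N where "N > 0" "\<forall>n. act N (f n) = f n" "\<forall>n. act N (g n) = g n"
    by (rule common_period[OF assms])
  then show ?thesis using conv_low[OF p q] conv_fixed by (intro seriesI) auto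
qed

lemma add_series:
  assumes "f \<in> series" "g \<in> series"
  shows "(\<lambda>n. f n + g n) \<in> series"
proof -
  obtain p where p: "\<forall>i<p. f i = 0" by (rule seriesE[OF assms(1)])
  obtain q where q: "\<forall>i<q. g i = 0" by (rule seriesE[OF assms(2)])
  obtain N where "N > 0" "\<forall>n. act N (f n) = f n" "\<forall>n. act N (g n) = g n"
    by (rule common_period[OF assms])
  then show ?thesis using p q by (intro seriesI[of "min p q"]) (auto simp: act_add)
qed

lemma minus_series: "f \<in> series \<Longrightarrow> (\<lambda>n. - f n) \<in> series"
  by (auto simp: series_def act_minus)

lemma zero_series: "(\<lambda>_. 0) \<in> series"
  by (rule seriesI[of 0 _ 1]) auto

lemma monomial_series:
  assumes "N > 0" "act N c = c"
  shows "monomial c k \<in> series"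
  using assms by (intro seriesI[of k _ N]) (auto simp: monomial_def)

lemma conv_assoc:
  assumes "f \<in> series" "g \<in> series" "h \<in> series"
  shows "conv (conv f g) h = conv f (conv g h)"
proof
  fix n
  obtain p where p: "\<forall>i<p. f i = 0" by (rule seriesE[OF assms(1)])
  obtain q where q: "\<forall>i<q. g i = 0" by (rule seriesE[OF assms(2)])
  obtain r where r: "\<forall>i<r. h i = 0" by (rule seriesE[OF assms(3)])
  \<comment> \<open>Neither range depends on the index of the other, so the double sum can be
    exchanged: \<open>f\<close> vanishes below \<open>p\<close> and \<open>conv g h\<close> below
    \<open>q + r\<close>, while \<open>conv f g\<close> vanishes below \<open>p + q\<close> and
    \<open>h\<close> below \<open>r\<close>.\<close>
  let ?I = "{p..n - (q + r)}" and ?M = "{p + q..n - r}"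
  have "conv (conv f g) h n = (\<Sum>m\<in>?M. conv f g m * act m (h (n - m)))"
    by (rule conv_bound[OF conv_low[OF p q] r order_refl order_refl])
  also have "\<dots> = (\<Sum>m\<in>?M. (\<Sum>i\<in>?I. f i * act i (g (m - i))) * act m (h (n - m)))"
    using conv_bound[OF p q order_refl] by (intro sum.cong) auto
  also have "\<dots> = (\<Sum>i\<in>?I. \<Sum>m\<in>?M. f i * act i (g (m - i)) * act m (h (n - m)))"
    unfolding sum_distrib_right by (rule sum.swap)
  also have "\<dots> = (\<Sum>i\<in>?I. f i * act i (\<Sum>j\<in>{p + q - i..n - i - r}. g j * act j (h (n - i - j))))"
  proof (rule sum.cong[OF refl])
    fix i
    \<comment> \<open>Substituting \<open>m = i + j\<close>, the twists agree because
      \<open>act (i + j)\<close> is \<open>act i\<close> after \<open>act j\<close>.\<close>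
    have "(\<Sum>m\<in>?M. f i * act i (g (m - i)) * act m (h (n - m)))
        = (\<Sum>j\<in>{p + q - i..n - i - r}. f i * (act i (g j) * act (i + j) (h (n - i - j))))"
      by (rule sum.reindex_bij_witness[of _ "\<lambda>j. i + j" "\<lambda>m. m - i"]) (auto simp: mult.assoc)
    then show "(\<Sum>m\<in>?M. f i * act i (g (m - i)) * act m (h (n - m)))
        = f i * act i (\<Sum>j\<in>{p + q - i..n - i - r}. g j * act j (h (n - i - j)))"
      by (simp add: act_sum act_mult act_add_left sum_distrib_left)
  qed
  also have "\<dots> = (\<Sum>i\<in>?I. f i * act i (conv g h (n - i)))"
  proof (rule sum.cong[OF refl])
    fix i assume "i \<in> ?I"
    then show "f i * act i (\<Sum>j\<in>{p + q - i..n - i - r}. g j * act j (h (n - i - j)))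
        = f i * act i (conv g h (n - i))"
      using conv_bound[OF q r, of "p + q - i" "n - i" "n - i - r"] by simp
  qed
  also have "\<dots> = conv f (conv g h) n"
    by (rule conv_bound[OF p conv_low[OF q r] order_refl order_refl, symmetric])
  finally show "conv (conv f g) h n = conv f (conv g h) n" .
qed

lemma conv_distrib:
  assumes "f \<in> series" "g \<in> series" "h \<in> series"
  shows "conv (\<lambda>n. f n + g n) h = (\<lambda>n. conv f h n + conv g h n)"
    and "conv h (\<lambda>n. f n + g n) = (\<lambda>n. conv h f n + conv h g n)"
proof -
  obtain p where p: "\<forall>i<p. f i = 0" by (rule seriesE[OF assms(1)])
  obtain q where q: "\<forall>i<q. g i = 0" by (rule seriesE[OF assms(2)])
  obtain r where r: "\<forall>i<r. h i = 0" by (rule seriesE[OF assms(3)])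
  let ?m = "min p q"
  have f: "\<forall>i<?m. f i = 0" and g: "\<forall>i<?m. g i = 0" and fg: "\<forall>i<?m. f i + g i = 0"
    using p q by auto
  show "conv (\<lambda>n. f n + g n) h = (\<lambda>n. conv f h n + conv g h n)"
    by (simp add: fun_eq_iff conv_bound[OF f r order_refl order_refl]
        conv_bound[OF g r order_refl order_refl] conv_bound[OF fg r order_refl order_refl]
        distrib_right sum.distrib)
  show "conv h (\<lambda>n. f n + g n) = (\<lambda>n. conv h f n + conv h g n)"
    by (simp add: fun_eq_iff conv_bound[OF r f order_refl order_refl]
        conv_bound[OF r g order_refl order_refl] conv_bound[OF r fg order_refl order_refl]
        distrib_left act_add sum.distrib)
qed

lemma conv_monomial_left: "conv (monomial c k) g n = c * act k (g (n - k))"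
  by (subst conv_eq[of "{k}"]) (auto simp: monomial_def split: if_splits)

lemma conv_monomial_right: "conv f (monomial c k) n = f (n - k) * act (n - k) c"
  by (subst conv_eq[of "{n - k}"]) (auto simp: monomial_def split: if_splits)

end

text \<open>With this congruence rule the recursive calls of \<open>skew_recip\<close> under the sum
  carry the bound \<open>j < k\<close>, which termination needs.\<close>

lemmas [fundef_cong] = sum.cong

text \<open>If \<open>z^m\<close> is the lowest power of \<open>z\<close> in \<^term>\<open>f\<close>, this is the coefficient of \<open>z^(k - m)\<close> in the
  right inverse of \<^term>\<open>f\<close>.\<close>

fun skew_recip :: "(int \<Rightarrow> 'a::field \<Rightarrow> 'a) \<Rightarrow> (int \<Rightarrow> 'a) \<Rightarrow> int \<Rightarrow> nat \<Rightarrow> 'a"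
  where "skew_recip act f m k = act (- m)
    (((if k = 0 then 1 else 0) -
      (\<Sum>j<k. f (m + int (k - j)) * act (m + int (k - j)) (skew_recip act f m j))) / f m)"

declare skew_recip.simps [simp del]

context field_int_action
begin

text \<open>The coefficient of \<open>z^k\<close> in the product contains the newest unknown only in
  \<open>f m * act m (h k)\<close>, with \<open>f m\<close> nonzero, so the unknowns are found
  recursively. They arise from coefficients of \<open>f\<close> by field operations and the action,
  hence keep its period.\<close>

lemma conv_right_inverse:
  assumes "f \<in> series" "f k \<noteq> 0"
  shows "\<exists>g\<in>series. conv f g = monomial 1 0"
proof -
  obtain p N where p: "\<forall>n<p. f n = 0" and N: "N > 0" "\<forall>n. act N (f n) = f n"
    by (rule seriesE[OF assms(1)])
  have "\<exists>m. f m \<noteq> 0 \<and> (\<forall>n<m. f n = 0)"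
  proof -
    \<comment> \<open>Counting from \<open>p\<close> turns the exponents into natural numbers, so
      that a lowest one exists.\<close>
    let ?P = "\<lambda>i. f (p + int i) \<noteq> 0"
    have "k \<ge> p" using p assms(2) by (meson not_le)
    then have "?P (nat (k - p))" using assms(2) by simp
    then have "?P (LEAST i. ?P i)" by (rule LeastI)
    moreover have "f n = 0" if "n < p + int (LEAST i. ?P i)" for n
    proof (cases "n < p")
      case False
      then have "\<not> ?P (nat (n - p))" using that by (intro not_less_Least) linarith
      then show ?thesis using False by simp
    qed (use p in simp)
    ultimately show ?thesis by blast
  qed
  then obtain m where m: "f m \<noteq> 0" "\<forall>n<m. f n = 0" by blast
  define h where "h = skew_recip act f m"
  \<comment> \<open>The recursion solved for the term with \<open>h k\<close>: \<open>act m\<close>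
    undoes the \<open>act (- m)\<close> in it.\<close>
  have h: "f m * act m (h k) = (if k = 0 then 1 else 0) - (\<Sum>j<k. f (m + int (k - j)) * act (m + int (k - j)) (h j))" for k
    using m(1) by (simp add: h_def skew_recip.simps[of act f m k] act_add_left[symmetric] act_zero_left)
  have hN: "act N (h k) = h k" for k
  proof (induction k rule: less_induct)
    case (less k)
    have "act N (if k = 0 then 1 else 0) = (if k = 0 then 1 else (0::'a))" by simp
    then show ?case
      unfolding h_def skew_recip.simps[of act f m k]
      using less by (simp add: act_commute[of N] act_divide act_diff act_sum act_mult N(2) h_def)
  qed
  define g where "g n = (if n < - m then 0 else h (nat (n + m)))" for n
  have g: "\<forall>n<(- m). g n = 0" by (simp add: g_def)
  have "g \<in> series"
    by (rule seriesI[OF g N(1)]) (simp add: g_def hN)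
  moreover have "conv f g = monomial 1 0"
  proof
    fix n
    show "conv f g n = monomial 1 0 n"
    proof (cases "n < 0")
      case True
      then show ?thesis using conv_low[OF m(2) g] by (simp add: monomial_def)
    next
      case False
      then obtain k where k: "n = int k" by (metis nonneg_int_cases not_less)
      have "conv f g n = (\<Sum>i\<in>{m..n + m}. f i * act i (g (n - i)))"
        using conv_bound[OF m(2) g, of m n "n + m"] by simp
      \<comment> \<open>As \<open>g\<close> starts at \<open>z^(- m)\<close>, its coefficient at
        \<open>j - m\<close> is \<open>h j\<close>, which meets the exponent
        \<open>i = m + (k - j)\<close> of \<open>f\<close>.\<close>
      also have "\<dots> = (\<Sum>j\<le>k. f (m + int (k - j)) * act (m + int (k - j)) (h j))"
        by (rule sum.reindex_bij_witness[of _ "\<lambda>j. m + int (k - j)" "\<lambda>i. nat (n - i + m)"])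
          (auto simp: k g_def of_nat_diff nat_le_iff intro!: arg_cong2[where f = "(*)"] arg_cong2[where f = act])
      also have "\<dots> = (\<Sum>j<k. f (m + int (k - j)) * act (m + int (k - j)) (h j)) + f m * act m (h k)"
        by (simp add: lessThan_Suc_atMost[symmetric])
      also have "\<dots> = monomial 1 0 n" by (simp add: h monomial_def k)
      finally show ?thesis .
    qed
  qed
  ultimately show ?thesis by blast
qed

end

text \<open>The series are transported along an injection, so that the division ring can live on a
  prescribed type of elements.\<close>

locale skew_laurent = field_int_action act for act :: "int \<Rightarrow> 'a::field \<Rightarrow> 'a" +
  fixes enc :: "(int \<Rightarrow> 'a) \<Rightarrow> 'd"
  assumes inj_enc: "inj enc"
begin

definition dec :: "'d \<Rightarrow> int \<Rightarrow> 'a"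
  where "dec = inv_into UNIV enc"

lemma dec_enc [simp]: "dec (enc f) = f"
  by (simp add: dec_def inj_enc)

definition D :: "'d ring"
  where "D = \<lparr>carrier = enc ` series, monoid.mult = (\<lambda>x y. enc (conv (dec x) (dec y))),
    one = enc (monomial 1 0), ring.zero = enc (\<lambda>_. 0), ring.add = (\<lambda>x y. enc (\<lambda>n. dec x n + dec y n))\<rparr>"

lemma D_simps [simp]:
  "carrier D = enc ` series" "x \<otimes>\<^bsub>D\<^esub> y = enc (conv (dec x) (dec y))" "\<one>\<^bsub>D\<^esub> = enc (monomial 1 0)"
  "\<zero>\<^bsub>D\<^esub> = enc (\<lambda>_. 0)" "x \<oplus>\<^bsub>D\<^esub> y = enc (\<lambda>n. dec x n + dec y n)"
  by (simp_all add: D_def)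

lemma enc_eq_iff [simp]: "enc f = enc g \<longleftrightarrow> f = g"
  using inj_enc by (auto dest: injD)

lemma enc_dec: "x \<in> carrier D \<Longrightarrow> enc (dec x) = x"
  by auto

lemma one_series: "monomial 1 0 \<in> series"
  by (rule monomial_series[of 1]) simp_all

lemma conv_one [simp]: "conv (monomial 1 0) f = f" "conv f (monomial 1 0) = f"
  by (simp_all add: fun_eq_iff conv_monomial_left conv_monomial_right act_zero_left)

lemma ring_D: "ring D"
proof (rule ringI)
  show "abelian_group D"
  proof (rule abelian_groupI)
    fix x assume "x \<in> carrier D"
    then obtain f where "x = enc f" "f \<in> series" by auto
    then show "\<exists>y\<in>carrier D. y \<oplus>\<^bsub>D\<^esub> x = \<zero>\<^bsub>D\<^esub>"
      using minus_series by (intro bexI[of _ "enc (\<lambda>n. - f n)"]) auto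
  qed (auto simp: add_series zero_series add_ac)
  show "monoid D"
    by (rule monoidI) (auto simp: conv_series one_series conv_assoc)
qed (auto simp: conv_distrib)

lemma skew_field_D: "skew_field D"
proof -
  interpret ring D by (rule ring_D)
  have right_inv: "\<exists>y\<in>carrier D. x \<otimes>\<^bsub>D\<^esub> y = \<one>\<^bsub>D\<^esub>" if x: "x \<in> carrier D" "x \<noteq> \<zero>\<^bsub>D\<^esub>" for x
  proof -
    obtain f where f: "x = enc f" "f \<in> series" using x(1) by auto
    then obtain k where "f k \<noteq> 0" using x(2) by auto
    then obtain g where "g \<in> series" "conv f g = monomial 1 0" using conv_right_inverse f by blast
    then show ?thesis by (intro bexI[of _ "enc g"]) (simp_all add: f)
  qed
  have ne: "\<one>\<^bsub>D\<^esub> \<noteq> \<zero>\<^bsub>D\<^esub>" by (auto simp: monomial_def fun_eq_iff)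
  \<comment> \<open>Right inverses of all nonzero elements are two-sided: if \<open>y\<close> is one
    of \<open>x\<close> and \<open>z\<close> is one of \<open>y\<close>, then \<open>x = z\<close>
    by associativity.\<close>
  have unit: "x \<in> Units D" if x: "x \<in> carrier D" "x \<noteq> \<zero>\<^bsub>D\<^esub>" for x
  proof -
    obtain y where y: "y \<in> carrier D" "x \<otimes>\<^bsub>D\<^esub> y = \<one>\<^bsub>D\<^esub>" using right_inv[OF x] by blast
    then have "y \<noteq> \<zero>\<^bsub>D\<^esub>" using ne x(1) by (metis r_null)
    then obtain z where z: "z \<in> carrier D" "y \<otimes>\<^bsub>D\<^esub> z = \<one>\<^bsub>D\<^esub>" using right_inv y(1) by blast
    have "x = z" using m_assoc[OF x(1) y(1) z(1)] unfolding y(2) z(2) by (simp only: l_one r_one x(1) z(1))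
    then show ?thesis using x(1) y z(2) unfolding Units_def by blast
  qed
  show ?thesis
  proof (intro skew_field.intro skew_field_axioms.intro ring_D ne equalityI subsetI)
    fix x assume x: "x \<in> Units D"
    then have "x \<noteq> \<zero>\<^bsub>D\<^esub>" using ne by (metis Units_closed Units_r_inv_ex l_null)
    then show "x \<in> carrier D - {\<zero>\<^bsub>D\<^esub>}" using x by blast
  qed (use unit in blast)
qed

section \<open>Central finiteness of the centralizers of powers of \<open>z\<close>\<close>

lemma dec_finsum:
  assumes "ring (D\<lparr>carrier := B\<rparr>)" "finite U" "g \<in> U \<rightarrow> B"
  shows "dec (finsum (D\<lparr>carrier := B\<rparr>) g U) n = (\<Sum>u\<in>U. dec (g u) n)"
proof -
  interpret B: ring "D\<lparr>carrier := B\<rparr>" by (rule assms(1))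
  show ?thesis using assms(2,3)
  proof (induction U)
    case (insert u U)
    then show ?case by (subst B.finsum_insert) auto
  qed simp
qed

text \<open>Multiplication by \<open>z^N\<close> on the right shifts the coefficients; on the left
  it also applies \<open>act N\<close> to them.\<close>

lemma centralizer_eq:
  "{x \<in> carrier D. x \<otimes>\<^bsub>D\<^esub> enc (monomial 1 N) = enc (monomial 1 N) \<otimes>\<^bsub>D\<^esub> x}
    = {x \<in> carrier D. \<forall>n. act N (dec x n) = dec x n}"
proof -
  have "(\<forall>n. f (n - N) = act N (f (n - N))) \<longleftrightarrow> (\<forall>n. act N (f n) = f n)" for f
    by (metis add_diff_cancel_right')
  then show ?thesis by (auto simp: fun_eq_iff conv_monomial_left conv_monomial_right)
qed

text \<open>The hypotheses make both twists trivial, so both products are the commutative Cauchy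
  product.\<close>

lemma conv_commute:
  assumes "f \<in> series" "g \<in> series"
    and "\<And>n i. f i \<noteq> 0 \<Longrightarrow> act i (g n) = g n" "\<And>n i. act i (f n) = f n"
  shows "conv f g = conv g f"
proof
  fix n
  obtain p where p: "\<forall>i<p. f i = 0" by (rule seriesE[OF assms(1)])
  obtain q where q: "\<forall>i<q. g i = 0" by (rule seriesE[OF assms(2)])
  have "conv f g n = (\<Sum>i\<in>{p..n - q}. f i * act i (g (n - i)))"
    by (rule conv_bound[OF p q order_refl order_refl])
  also have "\<dots> = (\<Sum>i\<in>{p..n - q}. f i * g (n - i))"
    using assms(3) by (intro sum.cong) auto
  also have "\<dots> = (\<Sum>i\<in>{q..n - p}. g i * f (n - i))"
    by (rule sum.reindex_bij_witness[of _ "\<lambda>i. n - i" "\<lambda>i. n - i"]) auto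
  also have "\<dots> = conv g f n"
    using conv_bound[OF q p order_refl order_refl, of n] assms(4) by simp
  finally show "conv f g n = conv g f n" .
qed

text \<open>The terms of a series \<open>f\<close> in \<open>B\<close> are sorted by the value
  \<open>c\<close> of the coefficient and the residue \<open>j\<close> of the exponent modulo
  \<open>N\<close>: \<open>f\<close> is the sum of all \<open>\<phi> (c, j) * c * z^j\<close>. Each
  \<open>\<phi> (c, j)\<close> is a series in \<open>z^N\<close> with coefficients 0 and 1, hence
  central, and there are finitely many pairs.\<close>

lemma centralizer_centrally_finite:
  assumes N: "N > 0" and fin: "finite {a. act N a = a}"
  defines "B \<equiv> {x \<in> carrier D. \<forall>n. act N (dec x n) = dec x n}"
  shows "subring B D" "skew_field (D\<lparr>carrier := B\<rparr>)" "centrally_finite (D\<lparr>carrier := B\<rparr>)"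
proof -
  interpret D: skew_field D by (rule skew_field_D)
  have "enc (monomial 1 N) \<in> carrier D" using monomial_series[of 1 1 N] by simp
  note B = D.centralizer_skew_subfield[OF this, unfolded centralizer_eq, folded B_def]
  then show "subring B D" and skew: "skew_field (D\<lparr>carrier := B\<rparr>)" by blast+
  interpret B: skew_field "D\<lparr>carrier := B\<rparr>" by (rule skew)
  \<comment> \<open>The value zero is excluded: the indicator of the vanishing coefficients would
    not be bounded below.\<close>
  let ?U = "{a. act N a = a \<and> a \<noteq> 0} \<times> {0..<N}"
  let ?u = "\<lambda>(c, j). enc (monomial c j)"
  show "centrally_finite (D\<lparr>carrier := B\<rparr>)"
  proof (rule B.centrally_finiteI)
    show "finite ?U" using finite_subset[OF _ fin] by auto
    show u: "?u \<in> ?U \<rightarrow> carrier (D\<lparr>carrier := B\<rparr>)"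
      using monomial_series[OF N] by (auto simp: B_def monomial_def)
    fix x assume "x \<in> carrier (D\<lparr>carrier := B\<rparr>)"
    then obtain f where x: "x = enc f" and f: "f \<in> series" "\<And>n. act N (f n) = f n"
      by (auto simp: B_def)
    define \<phi> where "\<phi> = (\<lambda>(c, j) n. if N dvd n \<and> f (n + j) = c then 1 else (0::'a))"
    have \<phi>_center: "enc (\<phi> u) \<in> center (D\<lparr>carrier := B\<rparr>)" if uU: "u \<in> ?U" for u
    proof -
      obtain c j where u: "u = (c, j)" "c \<noteq> 0" using uU by (cases u) auto
      obtain m where m: "\<forall>n<m. f n = 0" by (rule seriesE[OF f(1)])
      have fixed: "act i (\<phi> u n) = \<phi> u n" for i n by (simp add: \<phi>_def u)
      have s: "\<phi> u \<in> series"
      proof (rule seriesI[of "m - j" _ 1])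
        show "\<forall>n<m - j. \<phi> u n = 0" using m u(2) by (auto simp: \<phi>_def u(1))
      qed (simp_all add: fixed)
      have "conv (\<phi> u) g = conv g (\<phi> u)" if g: "g \<in> series" "\<And>n. act N (g n) = g n" for g
      proof (rule conv_commute[OF s g(1)])
        fix n i assume "\<phi> u i \<noteq> 0"
        then have "N dvd i" by (auto simp: \<phi>_def u split: if_splits)
        then show "act i (g n) = g n" using act_fixed_dvd g(2) by blast
      qed (rule fixed)
      then show ?thesis using s fixed by (auto simp: center_def B_def)
    qed
    show "\<exists>a\<in>?U \<rightarrow> center (D\<lparr>carrier := B\<rparr>).
        x = (\<Oplus>\<^bsub>D\<lparr>carrier := B\<rparr>\<^esub>i\<in>?U. a i \<otimes>\<^bsub>D\<lparr>carrier := B\<rparr>\<^esub> ?u i)"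
    proof (intro bexI[of _ "\<lambda>u. enc (\<phi> u)"])
      show "(\<lambda>u. enc (\<phi> u)) \<in> ?U \<rightarrow> center (D\<lparr>carrier := B\<rparr>)" using \<phi>_center by blast
      let ?g = "\<lambda>u. enc (\<phi> u) \<otimes>\<^bsub>D\<lparr>carrier := B\<rparr>\<^esub> ?u u"
      have "enc (\<phi> u) \<in> carrier (D\<lparr>carrier := B\<rparr>)" if "u \<in> ?U" for u
        using \<phi>_center[OF that] unfolding center_def by blast
      then have gB: "?g \<in> ?U \<rightarrow> carrier (D\<lparr>carrier := B\<rparr>)" using u by (intro Pi_I B.m_closed) blast+
      have "dec (finsum (D\<lparr>carrier := B\<rparr>) ?g ?U) n = f n" for n
      proof -
        have "dec (finsum (D\<lparr>carrier := B\<rparr>) ?g ?U) n = (\<Sum>u\<in>?U. dec (?g u) n)"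
          using gB \<open>finite ?U\<close> B.ring_axioms by (intro dec_finsum) auto
        \<comment> \<open>Only the pair of value and residue at \<open>n\<close> contributes; if
          \<open>f n = 0\<close>, it is missing from \<open>?U\<close> and the sum is zero as
          required.\<close>
        also have "\<dots> = (\<Sum>u\<in>?U. if u = (f n, n mod N) then f n else 0)"
        proof (rule sum.cong[OF refl])
          fix u assume "u \<in> ?U"
          then obtain c j where u: "u = (c, j)" "act N c = c" "0 \<le> j" "j < N" by auto
          have "N dvd n - j \<longleftrightarrow> j = n mod N"
            using u by (metis mod_eq_dvd_iff mod_pos_pos_trivial)
          moreover have "act (n - j) c = c" if "N dvd n - j" using act_fixed_dvd[OF u(2) that] .
          ultimately show "dec (?g u) n = (if u = (f n, n mod N) then f n else 0)"
            by (auto simp: u(1) conv_monomial_right \<phi>_def)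
        qed
        also have "\<dots> = f n"
          using \<open>finite ?U\<close> f(2) N by (auto simp: sum.delta)
        finally show ?thesis .
      qed
      then have "dec (finsum (D\<lparr>carrier := B\<rparr>) ?g ?U) = f" by blast
      moreover have "finsum (D\<lparr>carrier := B\<rparr>) ?g ?U \<in> carrier (D\<lparr>carrier := B\<rparr>)"
        using gB by (rule B.finsum_closed)
      ultimately show "x = finsum (D\<lparr>carrier := B\<rparr>) ?g ?U"
        by (auto simp: x B_def)
    qed
  qed
qed

lemma weakly_locally_finite_D:
  assumes fin: "\<And>N. N > 0 \<Longrightarrow> finite {a. act N a = a}"
  shows "weakly_locally_finite D"
  unfolding weakly_locally_finite_def
proof (intro allI impI)
  fix S assume S: "finite S \<and> S \<subseteq> carrier D"
  interpret D: skew_field D by (rule skew_field_D)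
  \<comment> \<open>A product of periods of the elements of \<open>S\<close> is a period for all of
    \<open>S\<close>.\<close>
  obtain N where N: "N > 0" "\<forall>x\<in>S. \<forall>n. act N (dec x n) = dec x n"
  proof -
    have "finite S" "S \<subseteq> carrier D" using S by auto
    then have "\<exists>N>0. \<forall>x\<in>S. \<forall>n. act N (dec x n) = dec x n"
    proof (induction S)
      case (insert x S)
      then obtain M where M: "M > 0" "\<forall>x\<in>S. \<forall>n. act M (dec x n) = dec x n" by auto
      have "dec x \<in> series" using insert by auto
      then obtain L where L: "L > 0" "\<forall>n. act L (dec x n) = dec x n" by (rule seriesE)
      have "\<forall>y\<in>insert x S. \<forall>n. act (L * M) (dec y n) = dec y n"
        using M(2) L(2) act_fixed_dvd[of L _ "L * M"] act_fixed_dvd[of M _ "L * M"] by simp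
      then show ?case using M(1) L(1) by (intro exI[of _ "L * M"]) simp
    qed (auto intro: exI[of _ 1])
    then show thesis using that by blast
  qed
  define B where "B = {x \<in> carrier D. \<forall>n. act N (dec x n) = dec x n}"
  note B = centralizer_centrally_finite[OF N(1) fin[OF N(1)], folded B_def]
  interpret B: skew_field "D\<lparr>carrier := B\<rparr>" by (rule B(2))
  let ?E = "generate_field D S"
  have "S \<subseteq> carrier D" "S \<subseteq> B" using S N(2) by (auto simp: B_def)
  note E = D.generate_field_skew_field[OF this(1)] and EB = D.generate_field_least[OF B(1,2) this(2)]
  \<comment> \<open>The result on division subrings is applied with \<open>B\<close> as the ambient
    ring, so \<open>?E\<close> has to be a subring of \<open>B\<close>.\<close>
  have "subring ?E (D\<lparr>carrier := B\<rparr>)"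
    using B.subring_iff[of ?E] EB D.subring_is_ring[OF E(1)] by simp
  then have "centrally_finite (D\<lparr>carrier := B\<rparr>\<lparr>carrier := ?E\<rparr>)"
    using B.centrally_finite_skew_subfield[OF B(3)] E(2) by simp
  then show "centrally_finite (D\<lparr>carrier := ?E\<rparr>)" by simp
qed

section \<open>The center of \<open>D\<close> and an element transcendental over it\<close>

lemma center_const:
  assumes periodic: "\<And>a. \<exists>N>0. act N a = a"
    and faithful: "\<And>N. N > 0 \<Longrightarrow> \<exists>a. act N a \<noteq> a"
    and x: "x \<in> center D" and n: "n \<noteq> 0"
  shows "dec x n = 0"
proof (rule ccontr)
  assume ne: "dec x n \<noteq> 0"
  \<comment> \<open>The constant \<open>a\<close> lies in \<open>D\<close> because it has a period.
    As it commutes with \<open>x\<close>, comparing coefficients at \<open>z^n\<close> gives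
    \<open>dec x n * act n a = a * dec x n\<close>, and \<open>dec x n\<close> cancels.\<close>
  have fixed: "act n a = a" for a
  proof -
    obtain N where "N > 0" "act N a = a" using periodic by blast
    then have "enc (monomial a 0) \<in> carrier D" using monomial_series by auto
    then have "conv (dec x) (monomial a 0) = conv (monomial a 0) (dec x)" using x by (auto simp: center_def)
    then have "conv (dec x) (monomial a 0) n = conv (monomial a 0) (dec x) n" by simp
    then show ?thesis using ne by (simp add: conv_monomial_left conv_monomial_right act_zero_left mult.commute)
  qed
  have "\<bar>n\<bar> > 0" using n by simp
  then obtain a where "act \<bar>n\<bar> a \<noteq> a" using faithful by blast
  then show False using act_fixed_dvd[OF fixed, of "\<bar>n\<bar>"] by simp
qed

text \<open>The transcendental element is \<open>z\<close>. Central coefficients are constants, so a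
  polynomial evaluated at \<open>z\<close> is a series from which its coefficients can be read
  off.\<close>

lemma not_algebraic_D:
  assumes periodic: "\<And>a. \<exists>N>0. act N a = a"
    and faithful: "\<And>N. N > 0 \<Longrightarrow> \<exists>a. act N a \<noteq> a"
  shows "\<not> algebraic_over_center D"
proof -
  interpret D: skew_field D by (rule skew_field_D)
  let ?z = "enc (monomial 1 1)"
  have z: "?z \<in> carrier D" using monomial_series[of 1 1 1] by simp
  have pow: "?z [^]\<^bsub>D\<^esub> (k::nat) = enc (monomial 1 (int k))" for k
  proof (induction k)
    case (Suc k)
    have "conv (monomial 1 (int k)) (monomial 1 1) = monomial 1 (int (Suc k))"
      by (rule ext, subst conv_monomial_right) (auto simp: monomial_def)
    then show ?case using Suc by simp
  qed simp
  note const = center_const[OF periodic faithful]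
  have eval: "dec (D.eval p ?z) n = (if n \<ge> 0 then dec (D.coeff p (nat n)) 0 else 0)"
    if "set p \<subseteq> center D" for p n
    using that
  proof (induction p)
    case (Cons a p)
    \<comment> \<open>Polynomials are lists with the leading coefficient first, so the head
      \<open>a\<close> belongs to the power \<open>length p\<close>, to which \<open>p\<close>
      contributes nothing.\<close>
    have "dec (a \<otimes>\<^bsub>D\<^esub> ?z [^]\<^bsub>D\<^esub> length p) n = (if n = int (length p) then dec a 0 else 0)"
      using const[of a] Cons.prems by (auto simp: pow conv_monomial_right)
    moreover have "D.coeff p (length p) = \<zero>\<^bsub>D\<^esub>" by (rule D.coeff_length) simp
    ultimately show ?case using Cons by auto
  qed simp
  have "D.transcendental (center D) ?z"
    unfolding D.transcendental_def
  proof (rule inj_onI)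
    fix p q assume pq: "p \<in> carrier (univ_poly D (center D))" "q \<in> carrier (univ_poly D (center D))"
      and e: "D.eval p ?z = D.eval q ?z"
    have pol: "polynomial\<^bsub>D\<^esub> (center D) p" "polynomial\<^bsub>D\<^esub> (center D) q"
      using pq by (simp_all add: univ_poly_def)
    have sub: "set p \<subseteq> center D" "set q \<subseteq> center D" using pol by (auto simp: polynomial_def)
    have zero: "\<zero>\<^bsub>D\<^esub> \<in> center D" using subringE(2)[OF subfieldE(1)[OF D.center_subfield]] .
    have coeff_mem: "D.coeff r i \<in> center D" if "set r \<subseteq> center D" for r i
      using that zero by (induction r) auto
    have "D.coeff p i = D.coeff q i" for i
    proof -
      have "dec (D.coeff p i) 0 = dec (D.coeff q i) 0"
        using eval[OF sub(1), of "int i"] eval[OF sub(2), of "int i"] e by simp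
      then have "dec (D.coeff p i) n = dec (D.coeff q i) n" for n
        using const coeff_mem sub by (cases "n = 0") auto
      then have "dec (D.coeff p i) = dec (D.coeff q i)" by blast
      then show ?thesis
        using enc_dec coeff_mem sub unfolding center_def by (metis (no_types, lifting) mem_Collect_eq)
    qed
    then show "p = q" using D.coeff_iff_polynomial_cond[OF pol] by blast
  qed
  then show ?thesis using z unfolding algebraic_over_center_def by blast
qed

end

section \<open>The Frobenius action on the algebraic closure of the two-element field\<close>

lemma uminus_bit_closure: "- (a :: bit alg_closure) = a"
proof -
  have "to_ac (1 + 1 :: bit) = (1 + 1 :: bit alg_closure)" by (simp only: to_ac_add to_ac_1)
  then have "(1 + 1 :: bit alg_closure) = 0" by simp
  then have "a + a = 0" by (metis distrib_left mult_1_right mult_zero_right)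
  then show ?thesis by (simp add: neg_eq_iff_add_eq_0)
qed

lemma frobenius_add: "((a :: bit alg_closure) + b) ^ 2 ^ n = a ^ 2 ^ n + b ^ 2 ^ n"
proof (induction n)
  case (Suc n)
  have "(x + y)\<^sup>2 = x\<^sup>2 + y\<^sup>2" for x y :: "bit alg_closure"
  proof -
    have "x * y + x * y = 0" by (metis uminus_bit_closure add.right_inverse)
    then show ?thesis by (simp add: power2_eq_square algebra_simps)
  qed
  then show ?case using Suc by (simp add: power_mult power_Suc2 del: power_Suc)
qed simp

lemma frobenius_eq_iff: "(a :: bit alg_closure) ^ 2 ^ n = b ^ 2 ^ n \<longleftrightarrow> a = b"
proof
  assume "a ^ 2 ^ n = b ^ 2 ^ n"
  then have "(a - b) ^ 2 ^ n = 0"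
    using frobenius_add[of a b n] by (metis uminus_bit_closure add.right_inverse diff_conv_add_uminus)
  then show "a = b" by simp
qed simp

lemma frobenius_root: "\<exists>b :: bit alg_closure. b ^ 2 ^ n = a"
  using nth_root_exists[of "2 ^ n" a] by auto

text \<open>The fixed elements are the roots of \<open>X^(2^n) - X\<close>, which is nonzero because
  its linear term survives for \<open>n > 0\<close>.\<close>

lemma finite_frobenius_fixed:
  assumes "n > 0"
  shows "finite {a :: bit alg_closure. a ^ 2 ^ n = a}"
proof -
  let ?p = "monom 1 (2 ^ n) - monom 1 1 :: bit alg_closure poly"
  have "2 ^ n \<noteq> (1::nat)" using assms by simp
  then have "coeff ?p 1 \<noteq> 0" by simp
  then have "?p \<noteq> 0" by (metis coeff_0)
  then have "finite {a. poly ?p a = 0}" by (rule poly_roots_finite)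
  then show ?thesis by (simp add: poly_monom)
qed

text \<open>A root of \<open>X^(2^n) - X - 1\<close> is moved by exactly 1.\<close>

lemma frobenius_not_identity:
  assumes "n > 0"
  shows "\<exists>a :: bit alg_closure. a ^ 2 ^ n \<noteq> a"
proof -
  let ?p = "monom 1 (2 ^ n) - monom 1 1 - 1 :: bit alg_closure poly"
  have "2 ^ n \<noteq> (1::nat)" using assms by simp
  then have "coeff ?p 1 \<noteq> 0" by simp
  then have "degree ?p > 0" by (metis le_degree less_le_trans zero_less_one)
  then obtain a where "poly ?p a = 0" using alg_closed_imp_poly_has_root by blast
  then have "a ^ 2 ^ n - a = 1" by (simp add: poly_monom)
  then have "a ^ 2 ^ n \<noteq> a" by auto
  then show ?thesis ..
qed

text \<open>Squaring fixes coefficients from the two-element field, so it maps roots of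
  \<open>p\<close> to roots of \<open>p\<close>. The orbit of \<open>a\<close> is therefore finite,
  and injectivity turns a repetition in it into a return to \<open>a\<close>.\<close>

lemma frobenius_periodic: "\<exists>n>0. (a :: bit alg_closure) ^ 2 ^ n = a"
proof -
  obtain p :: "bit poly" where p: "p \<noteq> 0" "poly (map_poly to_ac p) a = 0"
    by (rule alg_closure_algebraic)
  let ?Z = "{x. poly (map_poly to_ac p) x = 0}"
  have "map_poly to_ac p \<noteq> 0" using p(1) by (auto simp: poly_eq_iff coeff_map_poly)
  then have fin: "finite ?Z" by (rule poly_roots_finite)
  have sq: "poly (map_poly to_ac q) (x\<^sup>2) = (poly (map_poly to_ac q) x)\<^sup>2" for q :: "bit poly" and x
  proof (induction q)
    case (pCons c q)
    have "to_ac c = (to_ac c)\<^sup>2" by (cases c) auto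
    then show ?case
      using pCons frobenius_add[of "to_ac c" _ 1]
      by (simp add: map_poly_pCons power_mult_distrib)
  qed simp
  have "a ^ 2 ^ n \<in> ?Z" for n
  proof (induction n)
    case (Suc n)
    then show ?case using sq[of p "a ^ 2 ^ n"] by (simp add: power_mult power_Suc2 del: power_Suc)
  qed (use p in simp)
  then have "finite (range (\<lambda>n. a ^ 2 ^ n))" by (intro finite_subset[OF _ fin] image_subsetI)
  then have "\<not> inj (\<lambda>n. a ^ 2 ^ n)" using finite_imageD infinite_UNIV_nat by blast
  then obtain i j where "i < j" "a ^ 2 ^ i = a ^ 2 ^ j"
    unfolding inj_def by (metis nat_neq_iff)
  then have "(a ^ 2 ^ (j - i)) ^ 2 ^ i = a ^ 2 ^ i"
    by (simp add: power_mult[symmetric] power_add[symmetric])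
  then show ?thesis using \<open>i < j\<close> frobenius_eq_iff by (intro exI[of _ "j - i"]) auto
qed

text \<open>Needed to encode coefficients as real numbers. Every element is one of the finitely many
  roots of some nonzero polynomial over \<open>bit\<close>, and there are countably many such
  polynomials.\<close>

lemma countable_bit_closure: "countable (UNIV :: bit alg_closure set)"
proof -
  have "countable (range (coeffs :: bit poly \<Rightarrow> bit list))"
  proof (rule countable_subset[OF subset_UNIV])
    have "countable (UNIV :: bit set)"
      by (rule countable_finite) (rule finite_subset[of _ "{0, 1}"], auto intro: bit.exhaust)
    then show "countable (UNIV :: bit list set)" using countable_lists[of "UNIV :: bit set"] by simp
  qed
  then have "countable (UNIV :: bit poly set)"
    by (rule countable_image_inj_on) (simp add: inj_def coeffs_eq_iff)
  then have "countable (- {0 :: bit poly})" by (rule countable_subset[OF subset_UNIV])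
  moreover have "countable {x. poly (map_poly to_ac p) x = 0}" if "p \<in> - {0}" for p :: "bit poly"
  proof -
    have "map_poly to_ac p \<noteq> 0" using that by (auto simp: poly_eq_iff coeff_map_poly)
    then show ?thesis by (intro countable_finite poly_roots_finite)
  qed
  ultimately have "countable (\<Union>p \<in> - {0 :: bit poly}. {x. poly (map_poly to_ac p) x = 0})"
    by (rule countable_UN)
  moreover have "(\<Union>p \<in> - {0 :: bit poly}. {x. poly (map_poly to_ac p) x = 0}) = UNIV"
  proof (intro equalityI subsetI UNIV_I)
    fix x :: "bit alg_closure"
    obtain p :: "bit poly" where "p \<noteq> 0" "poly (map_poly to_ac p) x = 0"
      by (rule alg_closure_algebraic)
    then show "x \<in> (\<Union>p \<in> - {0 :: bit poly}. {x. poly (map_poly to_ac p) x = 0})" by blast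
  qed
  ultimately show ?thesis by simp
qed

text \<open>The Frobenius automorphism raised to the \<^term>\<open>i\<close>-th power; for negative \<^term>\<open>i\<close> the
  right-hand side is \<^term>\<open>a\<close> and the value is a root of \<^term>\<open>a\<close>.\<close>

definition frob :: "int \<Rightarrow> bit alg_closure \<Rightarrow> bit alg_closure"
  where "frob i a = (THE b. b ^ 2 ^ nat (- i) = a ^ 2 ^ nat i)"

lemma power_two_power_add: "(a :: 'a::monoid_mult) ^ 2 ^ (m + n) = (a ^ 2 ^ m) ^ 2 ^ n"
  by (simp add: power_add power_mult)

text \<open>Any way of writing \<open>i\<close> as a difference is allowed, since the
  \<open>k\<close> surplus squarings on both sides cancel by injectivity.\<close>

lemma frob_eqI:
  assumes "i = int m - int n" "b ^ 2 ^ n = a ^ 2 ^ m"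
  shows "frob i a = b"
proof -
  define k where "k = min m n"
  have "m = nat i + k" "n = nat (- i) + k" using assms(1) by (auto simp: k_def)
  then have "b ^ 2 ^ nat (- i) = a ^ 2 ^ nat i"
    using assms(2) by (simp add: power_two_power_add frobenius_eq_iff)
  then show ?thesis unfolding frob_def
    by (rule the_equality) (metis frobenius_eq_iff \<open>b ^ 2 ^ nat (- i) = a ^ 2 ^ nat i\<close>)
qed

lemma frob_power: "frob i a ^ 2 ^ nat (- i) = a ^ 2 ^ nat i"
proof -
  obtain b where b: "b ^ 2 ^ nat (- i) = a ^ 2 ^ nat i" using frobenius_root by blast
  then have "frob i a = b" by (intro frob_eqI) auto
  with b show ?thesis by simp
qed

lemma frob_of_nat: "frob (int n) a = a ^ 2 ^ n"
  by (rule frob_eqI[of _ n 0]) auto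

interpretation frob: field_int_action frob
proof
  fix i j :: int and a b :: "bit alg_closure"
  show "frob 0 a = a" using frob_of_nat[of 0] by simp
  show "frob (i + j) a = frob i (frob j a)"
  proof (rule frob_eqI)
    \<comment> \<open>Positive and negative parts are added separately; for opposite signs this is
      not the reduced form of \<open>i + j\<close>, which \<open>frob_eqI\<close> permits.\<close>
    show "i + j = int (nat i + nat j) - int (nat (- i) + nat (- j))" by auto
    show "frob i (frob j a) ^ 2 ^ (nat (- i) + nat (- j)) = a ^ 2 ^ (nat i + nat j)"
      using frob_power[of i "frob j a"] frob_power[of j a]
      by (metis power_two_power_add add.commute)
  qed
  show "frob i (a + b) = frob i a + frob i b"
    by (rule frob_eqI[of _ "nat i" "nat (- i)"]) (auto simp: frobenius_add frob_power)
  show "frob i (a * b) = frob i a * frob i b"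
    by (rule frob_eqI[of _ "nat i" "nat (- i)"]) (auto simp: power_mult_distrib frob_power)
qed

lemma frob_fixed_eq: "N > 0 \<Longrightarrow> {a. frob N a = a} = {a. a ^ 2 ^ nat N = a}"
  using frob_of_nat[of "nat N"] by simp

theorem proposition2p2:
  shows "\<exists>D :: elem ring.
    skew_field D \<and> weakly_locally_finite D \<and> \<not> algebraic_over_center D"
proof -
  \<comment> \<open>The argument \<open>s\<close> carries the exponent in its entry
    \<open>s 0\<close>, and countability numbers the coefficients. Evaluation at constant sequences
    recovers \<open>f\<close>.\<close>
  define enc :: "(int \<Rightarrow> bit alg_closure) \<Rightarrow> elem"
    where "enc f s = real (to_nat_on UNIV (f (s 0)))" for f s
  have "inj enc"
  proof (intro injI ext)
    fix f g n assume "enc f = enc g"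
    then have "enc f (\<lambda>_. n) = enc g (\<lambda>_. n)" by simp
    then show "f n = g n" by (simp add: enc_def countable_bit_closure)
  qed
  then interpret skew_laurent frob enc by unfold_locales
  have "finite {a. frob N a = a}" if "N > 0" for N
    using finite_frobenius_fixed[of "nat N"] that by (simp add: frob_fixed_eq)
  moreover have "\<exists>N>0. frob N a = a" for a
    using frobenius_periodic[of a] frob_of_nat by (metis of_nat_0_less_iff)
  moreover have "\<exists>a. frob N a \<noteq> a" if "N > 0" for N
    using frobenius_not_identity[of "nat N"] frob_fixed_eq[OF that] that by auto
  ultimately show ?thesis
    using skew_field_D weakly_locally_finite_D not_algebraic_D by blast
qed

end
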